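(* Let $M$ be a connected smooth manifold of dimension $n\ge3$ with a Riemannian conformal structure $c$. Let $g\in c$ and let $\gamma$ be an admissible family, with associated $\delta>0$, satisfying $g(\dot\gamma(0)(-),-)=2P^g$, where $P^g$ is the Schouten tensor of $g$. Let $(\widetilde M,\widetilde g)$ be the Lorentzian manifold constructed from $g$ and $\gamma$, let $\Psi\colon M\to\widetilde M$, $\Psi(x)=(1,0,x)$, and let $\xi=\partial_t|_\Psi$, $\ell=-\partial_r|_\Psi$. Let $\bigl(\Psi^*(T\widetilde M),\mathrm{Span}(\xi),\widetilde g,\widetilde\nabla\bigr)$ be the normal conformal tractor bundle associated with the pair $(\Psi,\xi)$. Let $W\in\overline{\mathfrak X}(M)=\Gamma(\Psi^*(T\widetilde M))$ be written as $$W=T\Psi\cdot W^\top+W_1\xi+W_2\ell,$$ with $W^\top\in\mathfrak X(M)$ and $W_1,W_2\in C^\infty(M)$. Then $W$ is a parallel section of this bundle (i.e. $\widetilde\nabla_VW=0$ for every $V\in\mathfrak X(M)$) if and only if $$\left\{\begin{aligned}&\nabla_VW^\top=-W_1V+W_2\widehat P^g(V),\\ &\widehat P^g(W^\top)=\nabla W_1,\\ &W^\top=-\nabla W_2,\end{aligned}\right.$$ for every $V\in\mathfrak X(M)$.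
   Context: **Schouten tensor.** $P^g=\frac1{n-2}\Bigl(\mathrm{Ric}^g-\frac{\mathrm S^g}{2(n-1)}g\Bigr)$, with $\mathrm{Ric}^g$ and $\mathrm S^g$ the Ricci and scalar curvatures of $g$. $\widehat P^g$ is the $(1,1)$-tensor field with $P^g(V,W)=g(\widehat P^g(V),W)$ for $V,W\in\mathfrak X(M)$. **Admissible family.** A smooth one-parameter family $\gamma$ of $(1,1)$-tensor fields $\gamma(r)$, $r\in\mathbb R$, on $M$ is admissible for $(M,c)$ if: (1) each $\gamma(r)$ is self-adjoint with respect to any metric of $c$; (2) $\gamma(0)=\mathrm{Id}$; (3) there is $\delta>0$ such that $\gamma(r)$ is nonsingular for all $|r|<\delta$. $\dot\gamma$ is the derivative of $\gamma$ in $r$. **The Lorentzian manifold.** $\widetilde M=\mathbb R_{>0}\times(-\delta,\delta)\times M$, with coordinates $(t,r)$ on the first two factors, and $$\widetilde g=d(rt)\otimes dt+dt\otimes d(rt)+t^2\,g(\gamma(r)(-),-).$$ **The immersion and the bundle.** $\Psi$ is a spacelike immersion with $\Psi^*(\widetilde g)=g$, and $\{\xi,\ell\}$ is a global lightlike frame of its normal bundle with $\widetilde g(\xi,\ell)=-1$. The tractor bundle associated with $(\Psi,\xi)$ is the pullback bundle $\Psi^*(T\widetilde M)\to M$ with distinguished lightlike line subbundle $\mathrm{Span}(\xi)$, bundle metric induced by $\widetilde g$, and connection $\widetilde\nabla$ the pullback to $\Psi^*(T\widetilde M)$ of the Levi-Civita connection of $\widetilde g$. Under the assumption $g(\dot\gamma(0)(-),-)=2P^g$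 this quadruple is the normal conformal tractor bundle of $(M,c)$, that is, the (unique up to isomorphism) standard conformal tractor bundle with normal tractor connection. **Notation.** $\nabla$ acting on vector fields is the Levi-Civita connection of $g$. For a function $f$, $\nabla f$ is its gradient with respect to $g$. $T\Psi$ is the differential of $\Psi$. *)

theory Defs
  imports "HOL-Analysis.Analysis" "HOL-Library.Function_Algebras"
begin

section \<open>Smooth manifolds\<close>

text \<open>
  Manifolds are modelled on a Euclidean space \<open>'e\<close>, so the dimension is \<open>DIM('e)\<close>. The atlas need
  not be maximal. A chart is a pair \<open>(U, phi)\<close>; only the values of \<open>phi\<close> on \<open>U\<close> matter.
  Functions, vector fields, tensors and so on on \<open>M\<close> are total HOL functions of which only the
  values at points of \<open>topspace (mtop M)\<close> matter.
\<close>

primrec Ck_on :: "nat \<Rightarrow> 'e::euclidean_space set \<Rightarrow> ('e \<Rightarrow> 'f::euclidean_space) \<Rightarrow> bool" where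
  "Ck_on 0 S f \<longleftrightarrow> continuous_on S f"
| "Ck_on (Suc k) S f \<longleftrightarrow>
     (\<forall>x\<in>S. f differentiable (at x)) \<and> (\<forall>v. Ck_on k S (\<lambda>x. frechet_derivative f (at x) v))"

text \<open>Used for open \<open>S\<close> only.\<close>
definition smooth_on :: "'e::euclidean_space set \<Rightarrow> ('e \<Rightarrow> 'f::euclidean_space) \<Rightarrow> bool" where
  "smooth_on S f \<longleftrightarrow> (\<forall>k. Ck_on k S f)"

type_synonym ('a, 'e) chart = "'a set \<times> ('a \<Rightarrow> 'e)"

record ('a, 'e) mfd =
  mtop :: "'a topology"
  atlas :: "('a, 'e) chart set"

abbreviation points :: "('a, 'e::euclidean_space) mfd \<Rightarrow> 'a set" where
  "points M \<equiv> topspace (mtop M)"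

definition smooth_manifold :: "('a, 'e::euclidean_space) mfd \<Rightarrow> bool" where
  "smooth_manifold M \<longleftrightarrow>
     Hausdorff_space (mtop M) \<and> second_countable (mtop M) \<and>
     points M = \<Union> (fst ` atlas M) \<and>
     (\<forall>(U, \<phi>) \<in> atlas M. openin (mtop M) U \<and> open (\<phi> ` U) \<and>
        homeomorphic_map (subtopology (mtop M) U) (top_of_set (\<phi> ` U)) \<phi>) \<and>
     (\<forall>(U, \<phi>) \<in> atlas M. \<forall>(V, \<psi>) \<in> atlas M.
        smooth_on (\<phi> ` (U \<inter> V)) (\<psi> \<circ> inv_into U \<phi>))"

definition euclidean_domain :: "'e::euclidean_space set \<Rightarrow> ('e, 'e) mfd" where
  "euclidean_domain S = \<lparr>mtop = top_of_set S, atlas = {(S, id)}\<rparr>"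

definition prod_manifold ::
    "('a, 'e) mfd \<Rightarrow> ('b, 'f) mfd \<Rightarrow> ('a \<times> 'b, 'e \<times> 'f) mfd" where
  "prod_manifold M N =
     \<lparr>mtop = prod_topology (mtop M) (mtop N),
      atlas = {(U \<times> V, map_prod \<phi> \<psi>) | U \<phi> V \<psi>. (U, \<phi>) \<in> atlas M \<and> (V, \<psi>) \<in> atlas N}\<rparr>"

definition smooth_funs :: "('a, 'e::euclidean_space) mfd \<Rightarrow> ('a \<Rightarrow> real) set" where
  "smooth_funs M = {f. \<forall>(U, \<phi>) \<in> atlas M. smooth_on (\<phi> ` U) (f \<circ> inv_into U \<phi>)}"


section \<open>Tangent vectors, sections along maps, tensor fields\<close>

text \<open>
  Tangent vectors are derivations on smooth functions, extended by 0 to nonsmooth functions so that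
  equality of functionals is equality of tangent vectors. The tangent space at a point consists of
  the coordinate directional derivatives \<open>f \<mapsto> D(f \<circ> phi\<^sup>-\<^sup>1)(phi p) v\<close>. Addition, negation and zero
  of tangent vectors are the pointwise ones of \<open>Function_Algebras\<close>.
\<close>

type_synonym 'a tvec = "('a \<Rightarrow> real) \<Rightarrow> real"

definition coord_vec ::
    "('a, 'e::euclidean_space) mfd \<Rightarrow> ('a, 'e) chart \<Rightarrow> 'a \<Rightarrow> 'e \<Rightarrow> 'a tvec" where
  "coord_vec M \<kappa> p v = (\<lambda>f. if f \<in> smooth_funs M
     then frechet_derivative (f \<circ> inv_into (fst \<kappa>) (snd \<kappa>)) (at (snd \<kappa> p)) v else 0)"

definition tangent_space :: "('a, 'e::euclidean_space) mfd \<Rightarrow> 'a \<Rightarrow> 'a tvec set" where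
  "tangent_space M p = {coord_vec M \<kappa> p v | \<kappa> v. \<kappa> \<in> atlas M \<and> p \<in> fst \<kappa>}"

definition tscale :: "real \<Rightarrow> 'a tvec \<Rightarrow> 'a tvec" where
  "tscale a u = (\<lambda>f. a * u f)"

definition tdiff :: "('a, 'e::euclidean_space) mfd \<Rightarrow> ('b \<Rightarrow> 'a) \<Rightarrow> 'b tvec \<Rightarrow> 'a tvec" where
  "tdiff M F u = (\<lambda>f. if f \<in> smooth_funs M then u (\<lambda>q. f (F q)) else 0)"

text \<open>
  The smooth sections of the pullback of \<open>TM\<close> along a smooth map \<open>F\<close> from \<open>N\<close> to \<open>M\<close>: fields of
  tangent vectors of \<open>M\<close> along \<open>F\<close> with smooth components in charts of \<open>N\<close> and \<open>M\<close>.
\<close>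
definition sections_along ::
    "('b, 'f::euclidean_space) mfd \<Rightarrow> ('a, 'e::euclidean_space) mfd \<Rightarrow> ('b \<Rightarrow> 'a)
      \<Rightarrow> ('b \<Rightarrow> 'a tvec) set" where
  "sections_along N M F = {W. \<forall>(V, \<psi>) \<in> atlas N. \<forall>(U, \<phi>) \<in> atlas M.
     \<exists>w. smooth_on (\<psi> ` (V \<inter> F -` U)) w \<and>
         (\<forall>q \<in> V \<inter> F -` U. W q = coord_vec M (U, \<phi>) (F q) (w (\<psi> q)))}"

abbreviation vector_fields ::
    "('a, 'e::euclidean_space) mfd \<Rightarrow> ('a \<Rightarrow> 'a tvec) set" where
  "vector_fields M \<equiv> sections_along M M (\<lambda>p. p)"

definition fscale :: "('b \<Rightarrow> real) \<Rightarrow> ('b \<Rightarrow> 'a tvec) \<Rightarrow> 'b \<Rightarrow> 'a tvec" where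
  "fscale h W = (\<lambda>q. tscale (h q) (W q))"

definition lie_bracket :: "('a \<Rightarrow> 'a tvec) \<Rightarrow> ('a \<Rightarrow> 'a tvec) \<Rightarrow> 'a \<Rightarrow> 'a tvec" where
  "lie_bracket X Y p = (\<lambda>f. X p (\<lambda>q. Y q f) - Y p (\<lambda>q. X q f))"

type_synonym 'a endo = "'a \<Rightarrow> 'a tvec \<Rightarrow> 'a tvec"
type_synonym 'a bilin = "'a \<Rightarrow> 'a tvec \<Rightarrow> 'a tvec \<Rightarrow> real"

definition tensor_11 :: "('a, 'e::euclidean_space) mfd \<Rightarrow> 'a endo \<Rightarrow> bool" where
  "tensor_11 M T \<longleftrightarrow>
     (\<forall>p \<in> points M. \<forall>u \<in> tangent_space M p. T p u \<in> tangent_space M p \<and>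
        (\<forall>v \<in> tangent_space M p. T p (u + v) = T p u + T p v) \<and>
        (\<forall>a. T p (tscale a u) = tscale a (T p u))) \<and>
     (\<forall>X \<in> vector_fields M. (\<lambda>p. T p (X p)) \<in> vector_fields M)"

definition riemannian_metric :: "('a, 'e::euclidean_space) mfd \<Rightarrow> 'a bilin \<Rightarrow> bool" where
  "riemannian_metric M g \<longleftrightarrow>
     (\<forall>p \<in> points M. \<forall>u \<in> tangent_space M p.
        (\<forall>v \<in> tangent_space M p. g p u v = g p v u \<and>
          (\<forall>w \<in> tangent_space M p. g p (u + v) w = g p u w + g p v w) \<and>
          (\<forall>a. g p (tscale a u) v = a * g p u v)) \<and>
        (u \<noteq> 0 \<longrightarrow> g p u u > 0)) \<and>
     (\<forall>X \<in> vector_fields M. \<forall>Y \<in> vector_fields M. (\<lambda>p. g p (X p) (Y p)) \<in> smooth_funs M)"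

definition riemannian_conformal_structure ::
    "('a, 'e::euclidean_space) mfd \<Rightarrow> 'a bilin set \<Rightarrow> bool" where
  "riemannian_conformal_structure M c \<longleftrightarrow>
     (\<exists>g. riemannian_metric M g \<and>
        c = {h. riemannian_metric M h \<and>
               (\<exists>u \<in> smooth_funs M. \<forall>p \<in> points M.
                  \<forall>v \<in> tangent_space M p. \<forall>w \<in> tangent_space M p.
                    h p v w = exp (2 * u p) * g p v w)})"


section \<open>Connections\<close>

type_synonym ('b, 'a) conn = "('b \<Rightarrow> 'b tvec) \<Rightarrow> ('b \<Rightarrow> 'a tvec) \<Rightarrow> 'b \<Rightarrow> 'a tvec"

text \<open>Linear connections on the pullback of \<open>TM\<close> along \<open>F\<close> from \<open>N\<close> to \<open>M\<close>.\<close>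
definition connection_along ::
    "('b, 'f::euclidean_space) mfd \<Rightarrow> ('a, 'e::euclidean_space) mfd \<Rightarrow> ('b \<Rightarrow> 'a)
      \<Rightarrow> ('b, 'a) conn \<Rightarrow> bool" where
  "connection_along N M F D \<longleftrightarrow>
     (\<forall>V \<in> vector_fields N. \<forall>W \<in> sections_along N M F.
        D V W \<in> sections_along N M F \<and>
        (\<forall>V' \<in> vector_fields N. \<forall>p \<in> points N. D (V + V') W p = D V W p + D V' W p) \<and>
        (\<forall>W' \<in> sections_along N M F. \<forall>p \<in> points N. D V (W + W') p = D V W p + D V W' p) \<and>
        (\<forall>h \<in> smooth_funs N. \<forall>p \<in> points N.
           D (fscale h V) W p = tscale (h p) (D V W p) \<and>
           D V (fscale h W) p = tscale (V p h) (W p) + tscale (h p) (D V W p)))"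

definition levi_civita_connection ::
    "('a, 'e::euclidean_space) mfd \<Rightarrow> 'a bilin \<Rightarrow> ('a, 'a) conn \<Rightarrow> bool" where
  "levi_civita_connection M g D \<longleftrightarrow>
     connection_along M M (\<lambda>p. p) D \<and>
     (\<forall>X \<in> vector_fields M. \<forall>Y \<in> vector_fields M. \<forall>p \<in> points M.
        D X Y p - D Y X p = lie_bracket X Y p) \<and>
     (\<forall>X \<in> vector_fields M. \<forall>Y \<in> vector_fields M. \<forall>Z \<in> vector_fields M. \<forall>p \<in> points M.
        X p (\<lambda>q. g q (Y q) (Z q)) = g p (D X Y p) (Z p) + g p (Y p) (D X Z p))"

text \<open>
  The pullback \<open>F\<^sup>*D\<close> of a connection \<open>D\<close> on \<open>TM\<close> is the connection along \<open>F\<close> determined by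
  \<open>(F\<^sup>*D)\<^sub>V (Z \<circ> F) = D\<^bsub>TF V\<^esub> Z\<close>. Here \<open>TF V\<close> at a point is extended to a vector field \<open>U\<close>
  of \<open>M\<close>, since \<open>D\<close> takes vector fields.
\<close>
definition pullback_connection ::
    "('b, 'f::euclidean_space) mfd \<Rightarrow> ('a, 'e::euclidean_space) mfd \<Rightarrow> ('b \<Rightarrow> 'a)
      \<Rightarrow> ('a, 'a) conn \<Rightarrow> ('b, 'a) conn \<Rightarrow> bool" where
  "pullback_connection N M F D DF \<longleftrightarrow>
     connection_along N M F DF \<and>
     (\<forall>V \<in> vector_fields N. \<forall>Z \<in> vector_fields M. \<forall>U \<in> vector_fields M. \<forall>p \<in> points N.
        U (F p) = tdiff M F (V p) \<longrightarrow> DF V (\<lambda>q. Z (F q)) p = D U Z (F p))"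

definition gradient_operator ::
    "('a, 'e::euclidean_space) mfd \<Rightarrow> 'a bilin \<Rightarrow> (('a \<Rightarrow> real) \<Rightarrow> 'a \<Rightarrow> 'a tvec) \<Rightarrow> bool" where
  "gradient_operator M g G \<longleftrightarrow>
     (\<forall>f \<in> smooth_funs M. G f \<in> vector_fields M \<and>
        (\<forall>V \<in> vector_fields M. \<forall>p \<in> points M. g p (G f p) (V p) = V p f))"


section \<open>Curvature and the Schouten tensor\<close>

text \<open>In this section \<open>D\<close> is the Levi-Civita connection of the Riemannian metric \<open>g\<close>.\<close>

definition curvature ::
    "('a, 'a) conn \<Rightarrow> ('a \<Rightarrow> 'a tvec) \<Rightarrow> ('a \<Rightarrow> 'a tvec) \<Rightarrow> ('a \<Rightarrow> 'a tvec) \<Rightarrow> 'a \<Rightarrow> 'a tvec" where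
  "curvature D X Y Z p = D X (D Y Z) p - D Y (D X Z) p - D (lie_bracket X Y) Z p"

definition orthonormal_at ::
    "('a, 'e::euclidean_space) mfd \<Rightarrow> 'a bilin \<Rightarrow> 'a \<Rightarrow> (nat \<Rightarrow> 'a \<Rightarrow> 'a tvec) \<Rightarrow> bool" where
  "orthonormal_at M g p E \<longleftrightarrow>
     (\<forall>i < DIM('e). E i \<in> vector_fields M) \<and>
     (\<forall>i < DIM('e). \<forall>j < DIM('e). g p (E i p) (E j p) = (if i = j then 1 else 0))"

text \<open>
  \<open>Ric(Y, Z) = tr (X \<mapsto> R(X, Y) Z)\<close> and \<open>S = tr\<^sub>g Ric\<close>, the traces being taken in vector fields that
  are orthonormal at the point. The value does not depend on these, hence the \<open>THE\<close>.
\<close>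
definition ricci ::
    "('a, 'e::euclidean_space) mfd \<Rightarrow> 'a bilin \<Rightarrow> ('a, 'a) conn
      \<Rightarrow> ('a \<Rightarrow> 'a tvec) \<Rightarrow> ('a \<Rightarrow> 'a tvec) \<Rightarrow> 'a \<Rightarrow> real" where
  "ricci M g D Y Z p = (THE s. \<exists>E. orthonormal_at M g p E \<and>
     s = (\<Sum>i<DIM('e). g p (curvature D (E i) Y Z p) (E i p)))"

definition scalar_curvature ::
    "('a, 'e::euclidean_space) mfd \<Rightarrow> 'a bilin \<Rightarrow> ('a, 'a) conn \<Rightarrow> 'a \<Rightarrow> real" where
  "scalar_curvature M g D p = (THE s. \<exists>E. orthonormal_at M g p E \<and>
     s = (\<Sum>i<DIM('e). ricci M g D (E i) (E i) p))"

definition schouten ::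
    "('a, 'e::euclidean_space) mfd \<Rightarrow> 'a bilin \<Rightarrow> ('a, 'a) conn
      \<Rightarrow> ('a \<Rightarrow> 'a tvec) \<Rightarrow> ('a \<Rightarrow> 'a tvec) \<Rightarrow> 'a \<Rightarrow> real" where
  "schouten M g D V W p = 1 / (real DIM('e) - 2) *
     (ricci M g D V W p
       - scalar_curvature M g D p / (2 * (real DIM('e) - 1)) * g p (V p) (W p))"

definition schouten_endomorphism ::
    "('a, 'e::euclidean_space) mfd \<Rightarrow> 'a bilin \<Rightarrow> ('a, 'a) conn \<Rightarrow> 'a endo \<Rightarrow> bool" where
  "schouten_endomorphism M g D T \<longleftrightarrow> tensor_11 M T \<and>
     (\<forall>V \<in> vector_fields M. \<forall>W \<in> vector_fields M. \<forall>p \<in> points M.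
        schouten M g D V W p = g p (T p (V p)) (W p))"


section \<open>Admissible families and the ambient Lorentzian manifold\<close>

text \<open>Smoothness of the family is joint smoothness of \<open>(r, x) \<mapsto> \<gamma>(r)\<^sub>x\<close> on \<open>\<real> \<times> M\<close>.\<close>
definition smooth_family_11 ::
    "('a, 'e::euclidean_space) mfd \<Rightarrow> (real \<Rightarrow> 'a endo) \<Rightarrow> bool" where
  "smooth_family_11 M \<gamma> \<longleftrightarrow>
     (\<forall>r. tensor_11 M (\<gamma> r)) \<and>
     (\<forall>X \<in> vector_fields M. (\<lambda>(r, x). \<gamma> r x (X x))
        \<in> sections_along (prod_manifold (euclidean_domain (UNIV :: real set)) M) M snd)"

definition family_deriv :: "(real \<Rightarrow> 'a endo) \<Rightarrow> real \<Rightarrow> 'a endo" where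
  "family_deriv \<gamma> r x u = (\<lambda>f. deriv (\<lambda>s. \<gamma> s x u f) r)"

definition nonsingular_below ::
    "('a, 'e::euclidean_space) mfd \<Rightarrow> (real \<Rightarrow> 'a endo) \<Rightarrow> real \<Rightarrow> bool" where
  "nonsingular_below M \<gamma> \<delta> \<longleftrightarrow>
     (\<forall>r. \<bar>r\<bar> < \<delta> \<longrightarrow> (\<forall>p \<in> points M.
        bij_betw (\<gamma> r p) (tangent_space M p) (tangent_space M p)))"

definition admissible_family ::
    "('a, 'e::euclidean_space) mfd \<Rightarrow> 'a bilin set \<Rightarrow> (real \<Rightarrow> 'a endo) \<Rightarrow> bool" where
  "admissible_family M c \<gamma> \<longleftrightarrow>
     smooth_family_11 M \<gamma> \<and>
     (\<forall>h \<in> c. \<forall>r. \<forall>p \<in> points M. \<forall>u \<in> tangent_space M p. \<forall>v \<in> tangent_space M p.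
        h p (\<gamma> r p u) v = h p u (\<gamma> r p v)) \<and>
     (\<forall>p \<in> points M. \<forall>u \<in> tangent_space M p. \<gamma> 0 p u = u) \<and>
     (\<exists>\<delta>>0. nonsingular_below M \<gamma> \<delta>)"

definition ambient ::
    "('a, 'e::euclidean_space) mfd \<Rightarrow> real
      \<Rightarrow> (real \<times> real \<times> 'a, real \<times> real \<times> 'e) mfd" where
  "ambient M \<delta> = prod_manifold (euclidean_domain {0<..})
     (prod_manifold (euclidean_domain {-\<delta><..<\<delta>}) M)"

text \<open>The differential of a function \<open>f\<close> evaluated on a tangent vector \<open>u\<close> is \<open>u f\<close>.\<close>
definition ambient_metric ::
    "('a, 'e::euclidean_space) mfd \<Rightarrow> 'a bilin \<Rightarrow> (real \<Rightarrow> 'a endo)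
      \<Rightarrow> (real \<times> real \<times> 'a) bilin" where
  "ambient_metric M g \<gamma> = (\<lambda>(t, r, x) u v.
     let dt = (\<lambda>w. w (\<lambda>(t', r', x'). t'));
         drt = (\<lambda>w. w (\<lambda>(t', r', x'). r' * t'));
         dpr = tdiff M (\<lambda>(t', r', x'). x')
     in drt u * dt v + dt u * drt v + t\<^sup>2 * g x (\<gamma> r x (dpr u)) (dpr v))"

definition partial_t ::
    "('a, 'e::euclidean_space) mfd \<Rightarrow> real \<Rightarrow> real \<times> real \<times> 'a \<Rightarrow> (real \<times> real \<times> 'a) tvec" where
  "partial_t M \<delta> = (\<lambda>(t, r, x) f.
     if f \<in> smooth_funs (ambient M \<delta>) then deriv (\<lambda>s. f (s, r, x)) t else 0)"

definition partial_r ::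
    "('a, 'e::euclidean_space) mfd \<Rightarrow> real \<Rightarrow> real \<times> real \<times> 'a \<Rightarrow> (real \<times> real \<times> 'a) tvec" where
  "partial_r M \<delta> = (\<lambda>(t, r, x) f.
     if f \<in> smooth_funs (ambient M \<delta>) then deriv (\<lambda>s. f (t, s, x)) r else 0)"

definition Psi :: "'a \<Rightarrow> real \<times> real \<times> 'a" where
  "Psi x = (1, 0, x)"

definition xi :: "('a, 'e::euclidean_space) mfd \<Rightarrow> real \<Rightarrow> 'a \<Rightarrow> (real \<times> real \<times> 'a) tvec" where
  "xi M \<delta> x = partial_t M \<delta> (Psi x)"

definition ell :: "('a, 'e::euclidean_space) mfd \<Rightarrow> real \<Rightarrow> 'a \<Rightarrow> (real \<times> real \<times> 'a) tvec" where
  "ell M \<delta> x = - partial_r M \<delta> (Psi x)"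


section \<open>The tractor bundle\<close>

text \<open>
  A vector bundle whose fibres consist of tangent vectors of another manifold, with its smooth
  sections, a line subbundle, a bundle metric and a connection.
\<close>
record ('b, 'a) tractor_bundle =
  tb_fibre :: "'b \<Rightarrow> 'a tvec set"
  tb_sections :: "('b \<Rightarrow> 'a tvec) set"
  tb_line :: "'b \<Rightarrow> 'a tvec set"
  tb_metric :: "'b \<Rightarrow> 'a tvec \<Rightarrow> 'a tvec \<Rightarrow> real"
  tb_conn :: "('b, 'a) conn"

definition associated_tractor_bundle ::
    "('b, 'f::euclidean_space) mfd \<Rightarrow> ('a, 'e::euclidean_space) mfd \<Rightarrow> 'a bilin
      \<Rightarrow> ('b, 'a) conn \<Rightarrow> ('b \<Rightarrow> 'a) \<Rightarrow> ('b \<Rightarrow> 'a tvec) \<Rightarrow> ('b, 'a) tractor_bundle" where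
  "associated_tractor_bundle N M g DF F \<xi> =
     \<lparr>tb_fibre = (\<lambda>p. tangent_space M (F p)),
      tb_sections = sections_along N M F,
      tb_line = (\<lambda>p. {tscale a (\<xi> p) | a. True}),
      tb_metric = (\<lambda>p. g (F p)),
      tb_conn = DF\<rparr>"

definition parallel_section ::
    "('b, 'f::euclidean_space) mfd \<Rightarrow> ('b, 'a) tractor_bundle \<Rightarrow> ('b \<Rightarrow> 'a tvec) \<Rightarrow> bool" where
  "parallel_section N B W \<longleftrightarrow>
     W \<in> tb_sections B \<and> (\<forall>V \<in> vector_fields N. \<forall>p \<in> points N. tb_conn B V W p = 0)"

end

theory Submission
  imports Defs
begin

text \<open>
  The three equations are the components of \<open>\<nabla>\<^sub>V W\<close> in the splitting of the tangent spaces of the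
  ambient manifold along \<open>\<Psi>\<close> into the tangent space of \<open>M\<close> and the span of \<open>\<partial>\<^sub>t\<close> and \<open>\<partial>\<^sub>r\<close>.

  Let \<open>X~\<close> be the lift to the ambient manifold of a vector field \<open>X\<close> of \<open>M\<close>, constant in \<open>t\<close> and \<open>r\<close>.
  All covariant derivatives are computed on the global fields \<open>a \<partial>\<^sub>t + b \<partial>\<^sub>r + X~\<close> with constant \<open>a\<close>
  and \<open>b\<close>. The bracket of two of them is the lift of the bracket on \<open>M\<close>, and their inner product is a
  polynomial in \<open>t\<close> and \<open>r\<close> plus \<open>t\<^sup>2 g(\<gamma>(r) X, Y)\<close>. The last term has at \<open>(1, 0, p)\<close> the derivatives
  \<open>2 g(X, Y)\<close> in the direction \<open>\<partial>\<^sub>t\<close> and \<open>2 P(X, Y)\<close> in the direction \<open>\<partial>\<^sub>r\<close>, where \<open>P\<close> is half the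
  derivative of \<open>g(\<gamma>(r) X, Y)\<close> at \<open>r = 0\<close>, here the Schouten tensor. Comparing the Koszul formula of
  the ambient metric with that of \<open>g\<close> gives along \<open>\<Psi>\<close> (lemma \<open>ambient_connection\<close>)
    \<open>\<nabla>\<^sub>V Y~ = (\<nabla>\<^sub>V Y)~ - P(V, Y) \<partial>\<^sub>t - g(V, Y) \<partial>\<^sub>r\<close>, \<open>\<nabla>\<^sub>V \<partial>\<^sub>t = V~\<close>, \<open>\<nabla>\<^sub>V \<partial>\<^sub>r = (Phat V)~\<close>.
  The Leibniz rule then expresses \<open>\<nabla>\<^sub>V W\<close> through the components of \<open>W\<close> (lemma
  \<open>tractor_derivative\<close>). Its vanishing for all \<open>V\<close> is the stated system, because \<open>P\<close> is symmetric (each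
  \<open>\<gamma>(r)\<close> is self-adjoint) and \<open>g\<close> is nondegenerate.

  Two points need analysis. First, the bracket formula rests on the symmetry of second derivatives.
  Secondly, a derivation is only meaningful on smooth functions, so \<open>g(\<gamma>(r) X, Y)\<close> must be known to be
  jointly smooth in \<open>r\<close> and the point. This is seen in local components, whereas smoothness of \<open>g\<close> is
  a statement about global vector fields; bump functions extend coordinate fields to global ones
  (lemma \<open>coord_field_extension\<close>).
\<close>


section \<open>Calculus of smooth maps between Euclidean spaces\<close>

lemma has_derivative_frechet:
  "f differentiable (at x) \<Longrightarrow> (f has_derivative frechet_derivative f (at x)) (at x)"
  by (simp add: frechet_derivative_works)

lemma frechet_derivative_eqI:
  "(f has_derivative f') (at x) \<Longrightarrow> frechet_derivative f (at x) = f'"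
  by (metis frechet_derivative_at)

lemma frechet_derivative_cong_open:
  assumes "open S" "x \<in> S" "\<And>y. y \<in> S \<Longrightarrow> f y = g y"
  shows "frechet_derivative f (at x) = frechet_derivative g (at x)"
proof -
  have "(f has_derivative D) (at x) \<longleftrightarrow> (g has_derivative D) (at x)" for D
    using assms has_derivative_transform_within_open[of _ _ x UNIV S] by (metis)
  then show ?thesis unfolding frechet_derivative_def by simp
qed

lemma differentiable_cong_open:
  assumes "open S" "x \<in> S" "\<And>y. y \<in> S \<Longrightarrow> f y = g y"
  shows "f differentiable (at x) \<longleftrightarrow> g differentiable (at x)"
  unfolding differentiable_def
    using assms has_derivative_transform_within_open[of _ _ x UNIV S] by (metis)

lemma Ck_on_cong:
  assumes "open S" "\<And>y. y \<in> S \<Longrightarrow> f y = g y"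
  shows "Ck_on k S f \<longleftrightarrow> Ck_on k S g"
  using assms(2)
proof (induction k arbitrary: f g)
  case 0
  then show ?case by (simp cong: continuous_on_cong)
next
  case (Suc k)
  have "Ck_on k S (\<lambda>x. frechet_derivative f (at x) v) = Ck_on k S (\<lambda>x. frechet_derivative g (at x) v)" for v
    by (rule Suc.IH) (simp add: frechet_derivative_cong_open[OF assms(1) _ Suc.prems])
  moreover have "f differentiable (at x) \<longleftrightarrow> g differentiable (at x)" if "x \<in> S" for x
    by (rule differentiable_cong_open[OF assms(1) that]) (rule Suc.prems)
  ultimately show ?case by auto
qed

lemma Ck_on_subset: "Ck_on k S f \<Longrightarrow> T \<subseteq> S \<Longrightarrow> Ck_on k T f"
  by (induction k arbitrary: f) (auto intro: continuous_on_subset)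

text \<open>
  Being \<open>C\<^sup>k\<close> is a local property. The set \<open>S\<close> itself need not be open.
\<close>

lemma Ck_on_local:
  assumes "\<And>x. x \<in> S \<Longrightarrow> \<exists>T. open T \<and> x \<in> T \<and> Ck_on k T f"
  shows "Ck_on k S f"
  using assms
proof (induction k arbitrary: f)
  case 0
  then show ?case
    by (auto simp: continuous_on_eq_continuous_within)
       (metis continuous_at_imp_continuous_at_within continuous_on_eq_continuous_within at_within_open)
next
  case (Suc k)
  then show ?case by (simp; meson)
qed

lemma Ck_on_SucD: "Ck_on (Suc k) S f \<Longrightarrow> Ck_on k S f"
  by (induction k arbitrary: f)
     (auto intro: continuous_at_imp_continuous_on differentiable_imp_continuous_within)

lemma Ck_on_const: "Ck_on k S (\<lambda>_. c)"
  by (induction k arbitrary: c) auto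

lemma Ck_on_linear:
  assumes "bounded_linear f"
  shows "Ck_on k S f"
proof (cases k)
  case (Suc m)
  have "(f has_derivative f) (at x)" for x using assms by (rule bounded_linear_imp_has_derivative)
  then show ?thesis
    using frechet_derivative_eqI[of f f] Ck_on_const[of m S] by (auto simp: Suc differentiable_def)
qed (use assms linear_continuous_on in auto)

lemma Ck_on_add:
  assumes "open S" "Ck_on k S f" "Ck_on k S g"
  shows "Ck_on k S (\<lambda>x. f x + g x)"
  using assms(2,3)
proof (induction k arbitrary: f g)
  case 0
  then show ?case by (auto intro: continuous_intros)
next
  case (Suc k)
  have "Ck_on k S (\<lambda>x. frechet_derivative (\<lambda>x. f x + g x) (at x) v)" for v
  proof -
    have "frechet_derivative (\<lambda>x. f x + g x) (at x) v
        = frechet_derivative f (at x) v + frechet_derivative g (at x) v" if "x \<in> S" for x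
      using that Suc.prems
      by (subst frechet_derivative_eqI[OF has_derivative_add[OF has_derivative_frechet has_derivative_frechet]]) auto
    then show ?thesis
      using Suc by (subst Ck_on_cong[OF assms(1)]) auto
  qed
  then show ?case using Suc.prems by auto
qed

lemma Ck_on_bilinear:
  assumes "bounded_bilinear b" "open S" "Ck_on k S f" "Ck_on k S g"
  shows "Ck_on k S (\<lambda>x. b (f x) (g x))"
  using assms(3,4)
proof (induction k arbitrary: f g)
  case 0
  then show ?case by (auto intro: bounded_bilinear.continuous_on[OF assms(1)])
next
  case (Suc k)
  have d: "((\<lambda>x. b (f x) (g x)) has_derivative
      (\<lambda>v. b (f x) (frechet_derivative g (at x) v) + b (frechet_derivative f (at x) v) (g x))) (at x)"
    if "x \<in> S" for x
    using that Suc.prems by (intro bounded_bilinear.FDERIV[OF assms(1)] has_derivative_frechet) auto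
  have "Ck_on k S (\<lambda>x. frechet_derivative (\<lambda>x. b (f x) (g x)) (at x) v)" for v
  proof -
    have "frechet_derivative (\<lambda>x. b (f x) (g x)) (at x) v
        = b (f x) (frechet_derivative g (at x) v) + b (frechet_derivative f (at x) v) (g x)" if "x \<in> S" for x
      using frechet_derivative_eqI[OF d[OF that]] by simp
    then show ?thesis
      using Suc.prems Ck_on_SucD[OF Suc.prems(1)] Ck_on_SucD[OF Suc.prems(2)]
      by (subst Ck_on_cong[OF assms(2)]) (auto intro!: Ck_on_add Suc.IH assms(2))
  qed
  then show ?case using d by (auto simp: differentiable_def)
qed

lemma Ck_on_sum:
  assumes "open S" "\<And>i. i \<in> I \<Longrightarrow> Ck_on k S (f i)"
  shows "Ck_on k S (\<lambda>x. \<Sum>i\<in>I. f i x)"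
  using assms(2)
  by (induction I rule: infinite_finite_induct) (auto intro!: Ck_on_const Ck_on_add assms(1))

lemma linear_expand_basis:
  fixes v :: "'e::euclidean_space"
  assumes "linear f"
  shows "f v = (\<Sum>b\<in>Basis. (v \<bullet> b) *\<^sub>R f b)"
proof -
  have "f v = f (\<Sum>b\<in>Basis. (v \<bullet> b) *\<^sub>R b)" by (simp add: euclidean_representation)
  also have "\<dots> = (\<Sum>b\<in>Basis. (v \<bullet> b) *\<^sub>R f b)"
    using assms by (simp add: linear_sum linear_cmul)
  finally show ?thesis .
qed

lemma Ck_on_compose:
  assumes "open S" "Ck_on k S f" "Ck_on k T g" "f ` S \<subseteq> T"
  shows "Ck_on k S (\<lambda>x. g (f x))"
  using assms(2,3)
proof (induction k arbitrary: g)
  case 0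
  then show ?case using assms(4) continuous_on_compose2 by auto
next
  case (Suc k)
  have fk: "Ck_on k S f" using Ck_on_SucD Suc.prems by blast
  have d: "((\<lambda>x. g (f x)) has_derivative
      (\<lambda>v. frechet_derivative g (at (f x)) (frechet_derivative f (at x) v))) (at x)"
    if "x \<in> S" for x
    using that Suc.prems assms(4)
    by (intro has_derivative_compose[of f _ x UNIV g] has_derivative_frechet) auto
  have "Ck_on k S (\<lambda>x. frechet_derivative (\<lambda>x. g (f x)) (at x) v)" for v
  proof -
    have "frechet_derivative (\<lambda>x. g (f x)) (at x) v
        = (\<Sum>b\<in>Basis. (frechet_derivative f (at x) v \<bullet> b) *\<^sub>R frechet_derivative g (at (f x)) b)"
      if "x \<in> S" for x
    proof -
      have "linear (frechet_derivative g (at (f x)))"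
        using that Suc.prems assms(4) by (intro linear_frechet_derivative) auto
      from linear_expand_basis[OF this] show ?thesis
        unfolding frechet_derivative_eqI[OF d[OF that]] .
    qed
    moreover have "Ck_on k S (\<lambda>x. \<Sum>b\<in>Basis. (frechet_derivative f (at x) v \<bullet> b) *\<^sub>R frechet_derivative g (at (f x)) b)"
    proof (intro Ck_on_sum assms(1) Ck_on_bilinear[OF bounded_bilinear_scaleR])
      fix b :: 'b
      show "Ck_on k S (\<lambda>x. frechet_derivative f (at x) v \<bullet> b)"
        using Suc.prems by (intro Ck_on_bilinear[OF bounded_bilinear_inner] Ck_on_const assms(1)) auto
      show "Ck_on k S (\<lambda>x. frechet_derivative g (at (f x)) b)"
        using Suc.prems by (intro Suc.IH fk) auto
    qed
    ultimately show ?thesis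
      by (subst Ck_on_cong[OF assms(1)]) auto
  qed
  then show ?case using d by (auto simp: differentiable_def)
qed

lemma smooth_on_cong:
  "open S \<Longrightarrow> (\<And>y. y \<in> S \<Longrightarrow> f y = g y) \<Longrightarrow> smooth_on S f \<longleftrightarrow> smooth_on S g"
  unfolding smooth_on_def using Ck_on_cong[of S f g] by blast

lemma smooth_on_subset: "smooth_on S f \<Longrightarrow> T \<subseteq> S \<Longrightarrow> smooth_on T f"
  unfolding smooth_on_def using Ck_on_subset by blast

lemma smooth_on_local:
  assumes "\<And>x. x \<in> S \<Longrightarrow> \<exists>T. open T \<and> x \<in> T \<and> smooth_on T f"
  shows "smooth_on S f"
  unfolding smooth_on_def using assms by (meson Ck_on_local smooth_on_def)

lemma smooth_on_const: "smooth_on S (\<lambda>_. c)"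
  by (simp add: smooth_on_def Ck_on_const)

lemma smooth_on_linear: "bounded_linear f \<Longrightarrow> smooth_on S f"
  by (simp add: smooth_on_def Ck_on_linear)

lemma smooth_on_add:
  "open S \<Longrightarrow> smooth_on S f \<Longrightarrow> smooth_on S g \<Longrightarrow> smooth_on S (\<lambda>x. f x + g x)"
  by (simp add: smooth_on_def Ck_on_add)

lemma smooth_on_bilinear:
  "bounded_bilinear b \<Longrightarrow> open S \<Longrightarrow> smooth_on S f \<Longrightarrow> smooth_on S g \<Longrightarrow> smooth_on S (\<lambda>x. b (f x) (g x))"
  by (simp add: smooth_on_def Ck_on_bilinear)

lemmas smooth_on_scaleR = smooth_on_bilinear[OF bounded_bilinear_scaleR]
lemmas smooth_on_inner = smooth_on_bilinear[OF bounded_bilinear_inner]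
lemmas smooth_on_mult = smooth_on_bilinear[OF bounded_bilinear_mult]

lemma smooth_on_sum:
  "open S \<Longrightarrow> (\<And>i. i \<in> I \<Longrightarrow> smooth_on S (f i)) \<Longrightarrow> smooth_on S (\<lambda>x. \<Sum>i\<in>I. f i x)"
  by (simp add: smooth_on_def Ck_on_sum)

lemma smooth_on_compose:
  "open S \<Longrightarrow> smooth_on S f \<Longrightarrow> smooth_on T g \<Longrightarrow> f ` S \<subseteq> T \<Longrightarrow> smooth_on S (\<lambda>x. g (f x))"
  unfolding smooth_on_def using Ck_on_compose by blast

lemma smooth_on_imp_differentiable: "smooth_on S f \<Longrightarrow> x \<in> S \<Longrightarrow> f differentiable (at x)"
  unfolding smooth_on_def by (metis Ck_on.simps(2))

lemma smooth_on_frechet_derivative: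
  "smooth_on S f \<Longrightarrow> smooth_on S (\<lambda>x. frechet_derivative f (at x) v)"
  unfolding smooth_on_def by (metis Ck_on.simps(2))

lemma smooth_on_imp_continuous_on: "smooth_on S f \<Longrightarrow> continuous_on S f"
  unfolding smooth_on_def by (metis Ck_on.simps(1))

text \<open>
  The derivative of \<open>f\<close> at a moving point \<open>x(y)\<close> in a moving direction \<open>w(y)\<close> is smooth: expand the
  direction in the standard basis.
\<close>

lemma smooth_on_directional_derivative:
  fixes f :: "'e::euclidean_space \<Rightarrow> 'f::euclidean_space"
    and x :: "'g::euclidean_space \<Rightarrow> 'e"
  assumes "open S" "open T" "smooth_on T f" "smooth_on S x" "x ` S \<subseteq> T" "smooth_on S w"
  shows "smooth_on S (\<lambda>y. frechet_derivative f (at (x y)) (w y))"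
proof -
  have "frechet_derivative f (at (x y)) (w y)
      = (\<Sum>b\<in>Basis. (w y \<bullet> b) *\<^sub>R frechet_derivative f (at (x y)) b)" if "y \<in> S" for y
    using that assms by (intro linear_expand_basis linear_frechet_derivative smooth_on_imp_differentiable) auto
  moreover have "smooth_on S (\<lambda>y. \<Sum>b\<in>Basis. (w y \<bullet> b) *\<^sub>R frechet_derivative f (at (x y)) b)"
  proof (rule smooth_on_sum[OF assms(1)], rule smooth_on_scaleR[OF assms(1)])
    fix b :: 'e
    show "smooth_on S (\<lambda>y. w y \<bullet> b)"
      by (rule smooth_on_inner[OF assms(1) assms(6) smooth_on_const])
    show "smooth_on S (\<lambda>y. frechet_derivative f (at (x y)) b)"
      by (rule smooth_on_compose[OF assms(1,4) smooth_on_frechet_derivative[OF assms(3)] assms(5)])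
  qed
  ultimately show ?thesis by (subst smooth_on_cong[OF assms(1)])
qed

lemma smooth_on_linear_compose:
  assumes "bounded_linear L" "open S" "smooth_on S f"
  shows "smooth_on S (\<lambda>x. L (f x))"
  by (rule smooth_on_compose[OF assms(2,3) smooth_on_linear[OF assms(1), of UNIV]]) simp

lemma smooth_on_Pair:
  assumes "open S" "smooth_on S f" "smooth_on S g"
  shows "smooth_on S (\<lambda>x. (f x, g x))"
proof -
  have "smooth_on S (\<lambda>x. (f x, 0) + (0, g x))"
    by (intro smooth_on_add assms smooth_on_linear_compose[where L = "\<lambda>a. (a, 0)"]
        smooth_on_linear_compose[where L = "\<lambda>b. (0, b)"] bounded_linear_Pair bounded_linear_ident bounded_linear_zero)
  then show ?thesis by simp
qed


subsection \<open>Second derivatives\<close>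

lemma DERIV_along_line:
  fixes F :: "'e::euclidean_space \<Rightarrow> real"
  assumes "F differentiable (at (x + s *\<^sub>R v))"
  shows "((\<lambda>s. F (x + s *\<^sub>R v)) has_real_derivative frechet_derivative F (at (x + s *\<^sub>R v)) v) (at s)"
proof -
  note F' = has_derivative_frechet[OF assms]
  have "((\<lambda>s. F (x + s *\<^sub>R v)) has_derivative
      (\<lambda>h. frechet_derivative F (at (x + s *\<^sub>R v)) (h *\<^sub>R v))) (at s)"
    by (rule has_derivative_compose[of "\<lambda>s. x + s *\<^sub>R v" "\<lambda>h. h *\<^sub>R v" s UNIV F, OF _ F'])
      (auto intro!: derivative_eq_intros)
  then show ?thesis
    by (simp add: has_field_derivative_def linear_cmul[OF linear_frechet_derivative[OF assms]]
        mult.commute[of _ "frechet_derivative _ _ _"] mult_commute_abs)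
qed

text \<open>
  The second difference of \<open>F\<close> over a parallelogram is, by applying the mean value theorem once in
  each direction, \<open>h\<^sup>2\<close> times a second derivative at an intermediate point. The left side is symmetric in \<open>u\<close> and
  \<open>v\<close>, which gives the symmetry of second derivatives as \<open>h\<close> tends to 0.
\<close>

lemma second_difference_mvt:
  fixes F :: "'e::euclidean_space \<Rightarrow> real"
  assumes F: "smooth_on S F" and "h > 0"
    and S: "\<And>s t. s \<in> {0..h} \<Longrightarrow> t \<in> {0..h} \<Longrightarrow> x + s *\<^sub>R u + t *\<^sub>R v \<in> S"
  shows "\<exists>s\<in>{0..h}. \<exists>t\<in>{0..h}. F (x + h *\<^sub>R u + h *\<^sub>R v) - F (x + h *\<^sub>R u) - F (x + h *\<^sub>R v) + F x
     = h * h * frechet_derivative (\<lambda>y. frechet_derivative F (at y) u) (at (x + s *\<^sub>R u + t *\<^sub>R v)) v"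
proof -
  define D where "D y = frechet_derivative F (at y) u" for y
  have D: "smooth_on S D" unfolding D_def by (rule smooth_on_frechet_derivative[OF F])
  have dF: "((\<lambda>s. F (y + s *\<^sub>R u)) has_real_derivative D (y + s *\<^sub>R u)) (at s)"
    if "y + s *\<^sub>R u \<in> S" for y s
    unfolding D_def by (rule DERIV_along_line[OF smooth_on_imp_differentiable[OF F that]])
  have "((\<lambda>s. F ((x + h *\<^sub>R v) + s *\<^sub>R u) - F (x + s *\<^sub>R u)) has_real_derivative
      D ((x + h *\<^sub>R v) + s *\<^sub>R u) - D (x + s *\<^sub>R u)) (at s)" if "0 \<le> s" "s \<le> h" for s
    using S[of s h] S[of s 0] that \<open>h > 0\<close>
    by (intro DERIV_diff dF) (simp_all add: algebra_simps)
  from MVT2[OF \<open>h > 0\<close> this] obtain s where s: "0 < s" "s < h"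
    "(F ((x + h *\<^sub>R v) + h *\<^sub>R u) - F (x + h *\<^sub>R u)) - (F (x + h *\<^sub>R v) - F x)
      = h * (D ((x + s *\<^sub>R u) + h *\<^sub>R v) - D (x + s *\<^sub>R u))"
    by (auto simp: algebra_simps)
  have "((\<lambda>t. D ((x + s *\<^sub>R u) + t *\<^sub>R v)) has_real_derivative
      frechet_derivative D (at ((x + s *\<^sub>R u) + t *\<^sub>R v)) v) (at t)" if "0 \<le> t" "t \<le> h" for t
    using that s S[of s t] by (intro DERIV_along_line smooth_on_imp_differentiable[OF D]) auto
  from MVT2[OF \<open>h > 0\<close> this] obtain t where t: "0 < t" "t < h"
    "D ((x + s *\<^sub>R u) + h *\<^sub>R v) - D (x + s *\<^sub>R u)
      = h * frechet_derivative D (at ((x + s *\<^sub>R u) + t *\<^sub>R v)) v" by auto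
  have "F (x + h *\<^sub>R u + h *\<^sub>R v) - F (x + h *\<^sub>R u) - F (x + h *\<^sub>R v) + F x
     = h * h * frechet_derivative D (at (x + s *\<^sub>R u + t *\<^sub>R v)) v"
    using s(3) unfolding t(3) by (simp add: algebra_simps)
  then show ?thesis
    using s t unfolding D_def by (intro bexI[of _ s] bexI[of _ t]) auto
qed

lemma second_derivative_symmetric:
  fixes F :: "'e::euclidean_space \<Rightarrow> real"
  assumes "open S" "smooth_on S F" "x \<in> S"
  shows "frechet_derivative (\<lambda>y. frechet_derivative F (at y) u) (at x) v
       = frechet_derivative (\<lambda>y. frechet_derivative F (at y) v) (at x) u"
proof (rule ccontr)
  define A where "A y = frechet_derivative (\<lambda>y. frechet_derivative F (at y) u) (at y) v" for y
  define B where "B y = frechet_derivative (\<lambda>y. frechet_derivative F (at y) v) (at y) u" for y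
  assume "\<not> ?thesis"
  then have ne: "A x \<noteq> B x" by (simp add: A_def B_def)
  \<comment> \<open>Half the gap: values within \<open>e\<close> of \<open>A x\<close> and of \<open>B x\<close> cannot coincide.\<close>
  define e where "e = \<bar>A x - B x\<bar> / 2"
  have e: "e > 0" using ne by (simp add: e_def)
  have AB: "smooth_on S A" "smooth_on S B"
    unfolding A_def B_def by (intro smooth_on_frechet_derivative assms)+
  then have "isCont A x" "isCont B x"
    using assms continuous_on_eq_continuous_at smooth_on_imp_continuous_on by blast+
  then obtain d1 d2 where d: "d1 > 0" "\<And>y. dist y x < d1 \<Longrightarrow> dist (A y) (A x) < e"
    "d2 > 0" "\<And>y. dist y x < d2 \<Longrightarrow> dist (B y) (B x) < e"
    using e unfolding continuous_at_eps_delta by metis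
  obtain d3 where d3: "d3 > 0" "ball x d3 \<subseteq> S" using assms openE by blast
  define d where "d = min d1 (min d2 d3)"
  have "d > 0" using d d3 by (simp add: d_def)
  \<comment> \<open>Keeps the whole parallelogram spanned by \<open>h u\<close> and \<open>h v\<close> within distance \<open>d\<close> of \<open>x\<close>;
    the summand 1 covers \<open>u = v = 0\<close>.\<close>
  define h where "h = d / (norm u + norm v + 1)"
  have nz: "norm u + norm v + 1 > 0" by (simp add: add_nonneg_pos)
  have h: "h > 0" using \<open>d > 0\<close> nz by (simp add: h_def)
  have h_less: "h * (norm u + norm v) < d"
  proof -
    have "h * (norm u + norm v) < h * (norm u + norm v + 1)" using h by simp
    also have "\<dots> = d" using nz by (simp add: h_def)
    finally show ?thesis .
  qed
  have norm_le: "norm (s *\<^sub>R p + t *\<^sub>R q) \<le> h * (norm p + norm q)"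
    if "s \<in> {0..h}" "t \<in> {0..h}" for s t and p q :: 'e
  proof -
    have "norm (s *\<^sub>R p + t *\<^sub>R q) \<le> s * norm p + t * norm q"
      using norm_triangle_ineq[of "s *\<^sub>R p" "t *\<^sub>R q"] that by simp
    also have "\<dots> \<le> h * norm p + h * norm q"
      using that by (intro add_mono mult_right_mono) auto
    finally show ?thesis by (simp add: algebra_simps)
  qed
  have near: "dist (x + s *\<^sub>R u + t *\<^sub>R v) x < d" "dist (x + s *\<^sub>R v + t *\<^sub>R u) x < d"
    if "s \<in> {0..h}" "t \<in> {0..h}" for s t
  proof -
    have "norm (s *\<^sub>R u + t *\<^sub>R v) < d" "norm (s *\<^sub>R v + t *\<^sub>R u) < d"
      using h_less norm_le[OF that, of u v] norm_le[OF that, of v u]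
      by (simp_all add: add.commute[of "norm v"])
    then show "dist (x + s *\<^sub>R u + t *\<^sub>R v) x < d" "dist (x + s *\<^sub>R v + t *\<^sub>R u) x < d"
      by (simp_all add: dist_norm add.assoc)
  qed
  have inS: "y \<in> S" if "dist y x < d" for y
    using that d3 by (auto simp: d_def dist_commute)
  obtain s t where st: "s \<in> {0..h}" "t \<in> {0..h}"
    "F (x + h *\<^sub>R u + h *\<^sub>R v) - F (x + h *\<^sub>R u) - F (x + h *\<^sub>R v) + F x = h * h * A (x + s *\<^sub>R u + t *\<^sub>R v)"
    using second_difference_mvt[OF assms(2) h inS[OF near(1)]] unfolding A_def by blast
  obtain s' t' where st': "s' \<in> {0..h}" "t' \<in> {0..h}"
    "F (x + h *\<^sub>R v + h *\<^sub>R u) - F (x + h *\<^sub>R v) - F (x + h *\<^sub>R u) + F x = h * h * B (x + s' *\<^sub>R v + t' *\<^sub>R u)"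
    using second_difference_mvt[OF assms(2) h inS[OF near(2)]] unfolding B_def by blast
  have "h * h * A (x + s *\<^sub>R u + t *\<^sub>R v) = h * h * B (x + s' *\<^sub>R v + t' *\<^sub>R u)"
    unfolding st(3)[symmetric] st'(3)[symmetric] by (simp add: algebra_simps)
  then have eq: "A (x + s *\<^sub>R u + t *\<^sub>R v) = B (x + s' *\<^sub>R v + t' *\<^sub>R u)" using h by simp
  have "dist (A (x + s *\<^sub>R u + t *\<^sub>R v)) (A x) < e" "dist (B (x + s' *\<^sub>R v + t' *\<^sub>R u)) (B x) < e"
    using d near(1)[OF st(1,2)] near(2)[OF st'(1,2)] by (auto simp: d_def)
  then show False unfolding eq by (auto simp: e_def dist_real_def abs_if field_simps split: if_splits)
qed


text \<open>
  The product rule for the function \<open>z \<mapsto> DF(z)(w(z))\<close>.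
\<close>

lemma frechet_derivative_directional:
  fixes F :: "'e::euclidean_space \<Rightarrow> real"
  assumes S: "open S" "y \<in> S" and F: "smooth_on S F" and w: "smooth_on S w"
  shows "frechet_derivative (\<lambda>z. frechet_derivative F (at z) (w z)) (at y) h
    = frechet_derivative F (at y) (frechet_derivative w (at y) h)
      + frechet_derivative (\<lambda>z. frechet_derivative F (at z) (w y)) (at y) h"
proof -
  define D where "D b = frechet_derivative (\<lambda>z. frechet_derivative F (at z) b) (at y)" for b
  have lin: "linear (frechet_derivative F (at z))" if "z \<in> S" for z
    using linear_frechet_derivative[OF smooth_on_imp_differentiable[OF F that]] .
  have D: "((\<lambda>z. frechet_derivative F (at z) b) has_derivative D b) (at y)" for b
    unfolding D_def using smooth_on_imp_differentiable[OF smooth_on_frechet_derivative[OF F] S(2)]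
    by (rule has_derivative_frechet)
  note w' = has_derivative_frechet[OF smooth_on_imp_differentiable[OF w S(2)]]
  have expand: "frechet_derivative F (at z) v = (\<Sum>b\<in>Basis. (v \<bullet> b) * frechet_derivative F (at z) b)"
    if "z \<in> S" for z v
    using linear_expand_basis[OF lin[OF that], of v] by simp
  have "((\<lambda>z. \<Sum>b\<in>Basis. (w z \<bullet> b) * frechet_derivative F (at z) b) has_derivative
     (\<lambda>h. \<Sum>b\<in>Basis. (w y \<bullet> b) * D b h + (frechet_derivative w (at y) h \<bullet> b) * frechet_derivative F (at y) b)) (at y)"
    by (intro has_derivative_sum has_derivative_mult has_derivative_inner_left w' D)
  then have "frechet_derivative (\<lambda>z. \<Sum>b\<in>Basis. (w z \<bullet> b) * frechet_derivative F (at z) b) (at y) =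
     (\<lambda>h. \<Sum>b\<in>Basis. (w y \<bullet> b) * D b h + (frechet_derivative w (at y) h \<bullet> b) * frechet_derivative F (at y) b)"
    by (rule frechet_derivative_eqI)
  moreover have "frechet_derivative (\<lambda>z. frechet_derivative F (at z) (w z)) (at y)
      = frechet_derivative (\<lambda>z. \<Sum>b\<in>Basis. (w z \<bullet> b) * frechet_derivative F (at z) b) (at y)"
    using expand by (intro frechet_derivative_cong_open[OF S])
  moreover have "((\<lambda>z. \<Sum>b\<in>Basis. (w y \<bullet> b) * frechet_derivative F (at z) b) has_derivative
     (\<lambda>h. \<Sum>b\<in>Basis. (w y \<bullet> b) * D b h)) (at y)"
    by (intro has_derivative_sum has_derivative_mult_right D)
  then have "frechet_derivative (\<lambda>z. \<Sum>b\<in>Basis. (w y \<bullet> b) * frechet_derivative F (at z) b) (at y) =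
     (\<lambda>h. \<Sum>b\<in>Basis. (w y \<bullet> b) * D b h)"
    by (rule frechet_derivative_eqI)
  moreover have "frechet_derivative (\<lambda>z. frechet_derivative F (at z) (w y)) (at y)
      = frechet_derivative (\<lambda>z. \<Sum>b\<in>Basis. (w y \<bullet> b) * frechet_derivative F (at z) b) (at y)"
    using expand by (intro frechet_derivative_cong_open[OF S])
  ultimately show ?thesis
    using expand[OF S(2), of "frechet_derivative w (at y) h"] by (simp add: sum.distrib)
qed


subsection \<open>Bump functions\<close>

text \<open>
  The functions \<open>s\<^sup>-\<^sup>n exp(-1/s)\<close> for \<open>s > 0\<close>, extended by 0. The derivative of each is a linear
  combination of two others, so all of them are smooth by a simultaneous induction.
\<close>

definition flat :: "nat \<Rightarrow> real \<Rightarrow> real" where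
  "flat n s = (if s > 0 then inverse s ^ n * exp (- inverse s) else 0)"

lemma flat_tendsto_0: "(flat n \<longlongrightarrow> 0) (at 0)"
proof (rule filterlim_split_at)
  have "((\<lambda>s::real. inverse s ^ n / exp (inverse s)) \<longlongrightarrow> 0) (at_right 0)"
    by (rule filterlim_compose[OF tendsto_power_div_exp_0 filterlim_inverse_at_top_right])
  moreover have "\<forall>\<^sub>F s in at_right 0. inverse s ^ n / exp (inverse s) = flat n s"
    by (auto simp: flat_def eventually_at_filter exp_minus field_simps)
  ultimately show "(flat n \<longlongrightarrow> 0) (at_right 0)" by (rule Lim_transform_eventually)
  have "\<forall>\<^sub>F s in at_left 0. 0 = flat n s"
    by (auto simp: flat_def eventually_at_filter)
  then show "(flat n \<longlongrightarrow> 0) (at_left 0)" by (rule Lim_transform_eventually[OF tendsto_const])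
qed

lemma DERIV_flat: "(flat n has_real_derivative flat (n + 2) s - real n * flat (n + 1) s) (at s)"
proof -
  consider "s > 0" | "s < 0" | "s = 0" by linarith
  then show ?thesis
  proof cases
    case 1
    have "((\<lambda>s. inverse s ^ n * exp (- inverse s)) has_real_derivative
        flat (n + 2) s - real n * flat (n + 1) s) (at s)"
      using 1
      by (cases n) (auto intro!: derivative_eq_intros simp: flat_def power2_eq_square algebra_simps,
        metis One_nat_def power_eq_if)
    then show ?thesis
      by (rule has_field_derivative_transform_within_open[where S = "{0<..}"]) (use 1 in \<open>auto simp: flat_def\<close>)
  next
    case 2
    have "((\<lambda>s. 0) has_real_derivative flat (n + 2) s - real n * flat (n + 1) s) (at s)"
      using 2 by (auto simp: flat_def)
    then show ?thesis
      by (rule has_field_derivative_transform_within_open[where S = "{..<0}"]) (use 2 in \<open>auto simp: flat_def\<close>)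
  next
    case 3
    have "\<forall>\<^sub>F h in at 0. flat (n + 1) h = (flat n (0 + h) - flat n 0) / h"
      by (auto simp: flat_def eventually_at_filter field_simps)
    then have "((\<lambda>h. (flat n (0 + h) - flat n 0) / h) \<longlongrightarrow> 0) (at 0)"
      by (rule Lim_transform_eventually[OF flat_tendsto_0])
    then show ?thesis unfolding 3 DERIV_def by (simp add: flat_def)
  qed
qed

lemma smooth_on_flat: "smooth_on UNIV (flat n)"
proof -
  have "Ck_on k UNIV (flat n)" for k n
  proof (induction k arbitrary: n)
    case 0
    show ?case using DERIV_flat by (auto intro!: continuous_at_imp_continuous_on DERIV_isCont)
  next
    case (Suc k)
    have d: "(flat n has_derivative (*) (flat (n + 2) s - real n * flat (n + 1) s)) (at s)" for s
      using DERIV_flat[of n s] by (simp add: has_field_derivative_def)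
    have "Ck_on k UNIV (\<lambda>s. frechet_derivative (flat n) (at s) v)" for v
    proof -
      have "Ck_on k UNIV (\<lambda>s. (flat (n + 2) s + (- real n) * flat (n + 1) s) * v)"
        by (intro Ck_on_bilinear[OF bounded_bilinear_mult] Ck_on_add Ck_on_const Suc.IH) auto
      then show ?thesis by (simp add: frechet_derivative_eqI[OF d] algebra_simps)
    qed
    then show ?case using d by (auto simp: differentiable_def)
  qed
  then show ?thesis by (simp add: smooth_on_def)
qed

lemma smooth_on_inverse: "smooth_on {x::real. x \<noteq> 0} inverse"
proof -
  have op: "open {x::real. x \<noteq> 0}" by (simp add: open_Collect_neq)
  have "Ck_on k {x::real. x \<noteq> 0} inverse" for k
  proof (induction k)
    case 0
    show ?case by (auto intro!: continuous_intros)
  next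
    case (Suc k)
    have d: "(inverse has_derivative (\<lambda>v. (inverse x * inverse x) * (- v))) (at x)" if "x \<noteq> 0" for x :: real
      using that by (auto intro!: derivative_eq_intros simp: algebra_simps)
    have "Ck_on k {x::real. x \<noteq> 0} (\<lambda>x. frechet_derivative inverse (at x) v)" for v
    proof -
      have "Ck_on k {x::real. x \<noteq> 0} (\<lambda>x. (inverse x * inverse x) * (- v))"
        by (intro Ck_on_bilinear[OF bounded_bilinear_mult] Ck_on_const Suc.IH op)
      then show ?thesis by (subst Ck_on_cong[OF op]) (auto simp: frechet_derivative_eqI[OF d])
    qed
    then show ?case using d by (auto simp: differentiable_def)
  qed
  then show ?thesis by (simp add: smooth_on_def)
qed

lemma ex_smooth_bump:
  fixes a :: "'e::euclidean_space"
  assumes "open \<Omega>" "a \<in> \<Omega>"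
  obtains \<beta> :: "'e \<Rightarrow> real" and T K where "smooth_on UNIV \<beta>" "open T" "a \<in> T" "\<And>y. y \<in> T \<Longrightarrow> \<beta> y = 1"
    "compact K" "K \<subseteq> \<Omega>" "\<And>y. y \<notin> K \<Longrightarrow> \<beta> y = 0"
proof -
  obtain \<rho> where \<rho>: "\<rho> > 0" "cball a \<rho> \<subseteq> \<Omega>" using assms open_contains_cball by blast
  define N where "N y = (y - a) \<bullet> (y - a)" for y
  define p where "p y = flat 0 (\<rho>\<^sup>2 + (-1) * N y)" for y
  define q where "q y = flat 0 (N y + (- (\<rho> / 2)\<^sup>2))" for y
  have N: "N y = (dist a y)\<^sup>2" for y
    unfolding N_def power2_norm_eq_inner[symmetric] by (simp add: dist_norm norm_minus_commute)
  have flat: "flat 0 s \<ge> 0" "flat 0 s > 0 \<longleftrightarrow> s > 0" for s by (auto simp: flat_def)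
  have sN: "smooth_on UNIV N"
    unfolding N_def using smooth_on_add[OF open_UNIV smooth_on_linear[OF bounded_linear_ident] smooth_on_const[of UNIV "- a"]]
    by (intro smooth_on_inner) auto
  have sp: "smooth_on UNIV p" unfolding p_def
    by (rule smooth_on_compose[OF open_UNIV _ smooth_on_flat],
        intro smooth_on_add smooth_on_mult smooth_on_const sN open_UNIV) simp
  have sq: "smooth_on UNIV q" unfolding q_def
    by (rule smooth_on_compose[OF open_UNIV _ smooth_on_flat],
        intro smooth_on_add smooth_on_const sN open_UNIV) simp
  have pos: "p y + q y > 0" for y
  proof (cases "dist a y < \<rho>")
    case True
    then have "(dist a y)\<^sup>2 < \<rho>\<^sup>2" by (intro power_strict_mono) auto
    then show ?thesis using flat by (simp add: p_def q_def N add_pos_nonneg)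
  next
    case False
    then have "(\<rho>/2)\<^sup>2 < (dist a y)\<^sup>2" using \<rho> by (intro power_strict_mono) auto
    then show ?thesis using flat by (simp add: p_def q_def N add_nonneg_pos)
  qed
  \<comment> \<open>The denominator is positive because \<open>p > 0\<close> inside radius \<open>\<rho>\<close> and \<open>q > 0\<close> outside radius \<open>\<rho>/2\<close>.\<close>
  show ?thesis
  proof (rule that[of "\<lambda>y. p y * inverse (p y + q y)" "ball a (\<rho> / 2)" "cball a \<rho>"])
    show "smooth_on UNIV (\<lambda>y. p y * inverse (p y + q y))"
    proof (rule smooth_on_mult[OF open_UNIV sp], rule smooth_on_compose[OF open_UNIV _ smooth_on_inverse])
      show "smooth_on UNIV (\<lambda>x. p x + q x)" by (intro smooth_on_add sp sq) auto
      show "(\<lambda>x. p x + q x) ` UNIV \<subseteq> {x. x \<noteq> 0}" using pos by (auto simp: less_imp_neq[symmetric])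
    qed
  next
    fix y assume "y \<in> ball a (\<rho> / 2)"
    then have "(dist a y)\<^sup>2 < (\<rho>/2)\<^sup>2" by (intro power_strict_mono) auto
    then have "q y = 0" by (simp add: q_def flat_def N)
    then show "p y * inverse (p y + q y) = 1" using pos[of y] by simp
  next
    fix y assume "y \<notin> cball a \<rho>"
    then have "\<rho>\<^sup>2 < (dist a y)\<^sup>2" using \<rho> by (intro power_strict_mono) auto
    then show "p y * inverse (p y + q y) = 0" by (simp add: p_def flat_def N)
  qed (use \<rho> in auto)
qed


section \<open>Tangent vectors and vector fields in charts\<close>

text \<open>
  The part of the definition of a smooth manifold that the calculus of vector fields in charts uses:
  the charts cover, are injective, and their overlaps have open images.
\<close>

definition charted :: "('a, 'e::euclidean_space) mfd \<Rightarrow> bool" where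
  "charted M \<longleftrightarrow> points M = \<Union> (fst ` atlas M) \<and>
     (\<forall>U \<phi>. (U, \<phi>) \<in> atlas M \<longrightarrow> inj_on \<phi> U) \<and>
     (\<forall>U \<phi> V \<psi>. (U, \<phi>) \<in> atlas M \<longrightarrow> (V, \<psi>) \<in> atlas M \<longrightarrow> open (\<phi> ` (U \<inter> V)))"

lemma charted_inj: "charted M \<Longrightarrow> (U, \<phi>) \<in> atlas M \<Longrightarrow> inj_on \<phi> U"
  unfolding charted_def by blast

lemma charted_open_inter:
  "charted M \<Longrightarrow> (U, \<phi>) \<in> atlas M \<Longrightarrow> (V, \<psi>) \<in> atlas M \<Longrightarrow> open (\<phi> ` (U \<inter> V))"
  unfolding charted_def by blast

lemma charted_open: "charted M \<Longrightarrow> (U, \<phi>) \<in> atlas M \<Longrightarrow> open (\<phi> ` U)"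
  using charted_open_inter[of M U \<phi> U \<phi>] by simp

lemma charted_chart_at:
  assumes "charted M" "p \<in> points M"
  obtains U \<phi> where "(U, \<phi>) \<in> atlas M" "p \<in> U"
  using assms unfolding charted_def by fastforce

lemma charted_subset: "charted M \<Longrightarrow> (U, \<phi>) \<in> atlas M \<Longrightarrow> p \<in> U \<Longrightarrow> p \<in> points M"
  unfolding charted_def by fastforce

lemma charted_inv: "charted M \<Longrightarrow> (U, \<phi>) \<in> atlas M \<Longrightarrow> p \<in> U \<Longrightarrow> inv_into U \<phi> (\<phi> p) = p"
  using charted_inj by (metis inv_into_f_f)

lemma smooth_manifold_chart:
  assumes "smooth_manifold M" "(U, \<phi>) \<in> atlas M"
  shows "openin (mtop M) U" "open (\<phi> ` U)"
    "homeomorphic_map (subtopology (mtop M) U) (top_of_set (\<phi> ` U)) \<phi>"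
  using assms unfolding smooth_manifold_def by blast+

lemma smooth_manifold_transition:
  "smooth_manifold M \<Longrightarrow> (U, \<phi>) \<in> atlas M \<Longrightarrow> (V, \<psi>) \<in> atlas M
    \<Longrightarrow> smooth_on (\<phi> ` (U \<inter> V)) (\<psi> \<circ> inv_into U \<phi>)"
  unfolding smooth_manifold_def by blast

lemma smooth_manifold_open_image:
  assumes "smooth_manifold M" "(U, \<phi>) \<in> atlas M" "openin (mtop M) A"
  shows "open (\<phi> ` (U \<inter> A))"
proof -
  note c = smooth_manifold_chart[OF assms(1,2)]
  have "openin (subtopology (mtop M) U) (U \<inter> A)"
    using assms(3) by (auto simp: openin_subtopology)
  then have "openin (top_of_set (\<phi> ` U)) (\<phi> ` (U \<inter> A))"
    using homeomorphic_imp_open_map[OF c(3)] by (simp add: open_map_def)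
  then show ?thesis using c(2) openin_open_trans by blast
qed

lemma smooth_manifold_charted:
  assumes "smooth_manifold M" shows "charted M"
proof -
  have "inj_on \<phi> U" if "(U, \<phi>) \<in> atlas M" for U \<phi>
  proof -
    have "U \<subseteq> points M" using smooth_manifold_chart(1)[OF assms that] by (rule openin_subset)
    then show ?thesis
      using homeomorphic_imp_injective_map[OF smooth_manifold_chart(3)[OF assms that]]
      by (simp add: Int_absorb1)
  qed
  moreover have "open (\<phi> ` (U \<inter> V))" if "(U, \<phi>) \<in> atlas M" "(V, \<psi>) \<in> atlas M" for U \<phi> V \<psi>
    by (rule smooth_manifold_open_image[OF assms that(1) smooth_manifold_chart(1)[OF assms that(2)]])
  moreover have "points M = \<Union> (fst ` atlas M)"
    using assms unfolding smooth_manifold_def by blast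
  ultimately show ?thesis unfolding charted_def by blast
qed

lemma smooth_funsD:
  "f \<in> smooth_funs M \<Longrightarrow> (U, \<phi>) \<in> atlas M \<Longrightarrow> smooth_on (\<phi> ` U) (f \<circ> inv_into U \<phi>)"
  unfolding smooth_funs_def by blast

lemma smooth_funsI:
  assumes "charted M"
    and "\<And>U \<phi>. (U, \<phi>) \<in> atlas M \<Longrightarrow>
      \<exists>h. smooth_on (\<phi> ` U) h \<and> (\<forall>p\<in>U. f p = h (\<phi> p))"
  shows "f \<in> smooth_funs M"
  unfolding smooth_funs_def
proof clarify
  fix U \<phi> assume c: "(U, \<phi>) \<in> atlas M"
  then obtain h where h: "smooth_on (\<phi> ` U) h" "\<forall>p\<in>U. f p = h (\<phi> p)" using assms(2) by blast
  show "smooth_on (\<phi> ` U) (f \<circ> inv_into U \<phi>)"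
    using h by (subst smooth_on_cong[OF charted_open[OF assms(1) c], of _ h])
      (auto simp: charted_inv[OF assms(1) c])
qed

lemma smooth_funs_cong:
  assumes "charted M" "\<And>p. p \<in> points M \<Longrightarrow> f p = g p"
  shows "f \<in> smooth_funs M \<longleftrightarrow> g \<in> smooth_funs M"
proof -
  have "smooth_on (\<phi> ` U) (f \<circ> inv_into U \<phi>) = smooth_on (\<phi> ` U) (g \<circ> inv_into U \<phi>)"
    if "(U, \<phi>) \<in> atlas M" for U \<phi>
    using assms(2) charted_subset[OF assms(1) that]
    by (intro smooth_on_cong charted_open[OF assms(1) that]) (auto simp: charted_inv[OF assms(1) that])
  then show ?thesis unfolding smooth_funs_def by blast
qed

lemma smooth_funs_const: "(\<lambda>_. c) \<in> smooth_funs M"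
  unfolding smooth_funs_def by (auto simp: o_def smooth_on_const)

lemma smooth_funs_add:
  assumes M: "charted M" and f: "f \<in> smooth_funs M" and g: "g \<in> smooth_funs M"
  shows "(\<lambda>p. f p + g p) \<in> smooth_funs M"
proof (rule smooth_funsI[OF M])
  fix U \<phi> assume c: "(U, \<phi>) \<in> atlas M"
  show "\<exists>h. smooth_on (\<phi> ` U) h \<and> (\<forall>p\<in>U. f p + g p = h (\<phi> p))"
    using smooth_on_add[OF charted_open[OF M c] smooth_funsD[OF f c] smooth_funsD[OF g c]]
    by (intro exI conjI) (auto simp: charted_inv[OF M c])
qed

lemma smooth_funs_mult:
  assumes M: "charted M" and f: "f \<in> smooth_funs M" and g: "g \<in> smooth_funs M"
  shows "(\<lambda>p. f p * g p) \<in> smooth_funs M"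
proof (rule smooth_funsI[OF M])
  fix U \<phi> assume c: "(U, \<phi>) \<in> atlas M"
  show "\<exists>h. smooth_on (\<phi> ` U) h \<and> (\<forall>p\<in>U. f p * g p = h (\<phi> p))"
    using smooth_on_mult[OF charted_open[OF M c] smooth_funsD[OF f c] smooth_funsD[OF g c]]
    by (intro exI conjI) (auto simp: charted_inv[OF M c])
qed

lemma coord_vec_smooth:
  "f \<in> smooth_funs M \<Longrightarrow> coord_vec M (U, \<phi>) p v f = frechet_derivative (f \<circ> inv_into U \<phi>) (at (\<phi> p)) v"
  by (simp add: coord_vec_def)

lemma coord_vec_nonsmooth: "f \<notin> smooth_funs M \<Longrightarrow> coord_vec M \<kappa> p v f = 0"
  by (simp add: coord_vec_def)

lemma coord_vec_cong:
  assumes "charted M" "(U, \<phi>) \<in> atlas M" "p \<in> U" "\<And>p. p \<in> points M \<Longrightarrow> f p = g p"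
  shows "coord_vec M (U, \<phi>) p v f = coord_vec M (U, \<phi>) p v g"
proof -
  have "frechet_derivative (f \<circ> inv_into U \<phi>) (at (\<phi> p)) = frechet_derivative (g \<circ> inv_into U \<phi>) (at (\<phi> p))"
    using assms(3,4) charted_subset[OF assms(1,2)]
    by (intro frechet_derivative_cong_open[OF charted_open[OF assms(1,2)]])
       (auto simp: charted_inv[OF assms(1,2)])
  then show ?thesis
    using smooth_funs_cong[OF assms(1,4)] by (simp add: coord_vec_def)
qed

lemma coord_expr_differentiable:
  assumes "f \<in> smooth_funs M" "(U, \<phi>) \<in> atlas M" "p \<in> U"
  shows "(f \<circ> inv_into U \<phi>) differentiable (at (\<phi> p))"
  using smooth_on_imp_differentiable[OF smooth_funsD[OF assms(1,2)]] assms(3) by blast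

lemma coord_vec_add:
  assumes "(U, \<phi>) \<in> atlas M" "p \<in> U"
  shows "coord_vec M (U, \<phi>) p (v + w) = coord_vec M (U, \<phi>) p v + coord_vec M (U, \<phi>) p w"
  using linear_add[OF linear_frechet_derivative[OF coord_expr_differentiable[OF _ assms]]]
  by (auto simp: coord_vec_def)

lemma coord_vec_scale:
  assumes "(U, \<phi>) \<in> atlas M" "p \<in> U"
  shows "coord_vec M (U, \<phi>) p (a *\<^sub>R v) = tscale a (coord_vec M (U, \<phi>) p v)"
  using linear_cmul[OF linear_frechet_derivative[OF coord_expr_differentiable[OF _ assms]]]
  by (auto simp: coord_vec_def tscale_def)

lemma coord_vec_0:
  assumes "(U, \<phi>) \<in> atlas M" "p \<in> U" shows "coord_vec M (U, \<phi>) p 0 = 0"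
  using coord_vec_scale[OF assms, of 0 0] by (simp add: tscale_def fun_eq_iff)

lemma coord_vec_tangent:
  "(U, \<phi>) \<in> atlas M \<Longrightarrow> p \<in> U \<Longrightarrow> coord_vec M (U, \<phi>) p v \<in> tangent_space M p"
  unfolding tangent_space_def by force

lemma tangent_spaceE:
  assumes "u \<in> tangent_space M p"
  obtains U \<phi> v where "(U, \<phi>) \<in> atlas M" "p \<in> U" "u = coord_vec M (U, \<phi>) p v"
  using assms unfolding tangent_space_def by auto

text \<open>
  Tangent vectors do not see the values of a function off \<open>points M\<close>. Many identities between functions
  hold at points of \<open>M\<close> only, so this is needed throughout.
\<close>

lemma tangent_cong:
  assumes "charted M" "u \<in> tangent_space M p" "\<And>p. p \<in> points M \<Longrightarrow> f p = g p"
  shows "u f = u g"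
proof -
  obtain U \<phi> v where c: "(U, \<phi>) \<in> atlas M" "p \<in> U" "u = coord_vec M (U, \<phi>) p v"
    using assms(2) by (rule tangent_spaceE)
  then show ?thesis using coord_vec_cong[OF assms(1) c(1,2) assms(3)] by simp
qed

lemma tangent_nonsmooth: "u \<in> tangent_space M p \<Longrightarrow> f \<notin> smooth_funs M \<Longrightarrow> u f = 0"
  by (elim tangent_spaceE) (simp add: coord_vec_nonsmooth)

lemma tangent_const: "u \<in> tangent_space M p \<Longrightarrow> u (\<lambda>_. c) = 0"
  by (elim tangent_spaceE) (simp add: coord_vec_smooth[OF smooth_funs_const] o_def)

lemma tangent_locally_const:
  assumes "charted M" "u \<in> tangent_space M p" "\<And>p. p \<in> points M \<Longrightarrow> f p = c"
  shows "u f = 0"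
  using tangent_cong[OF assms(1,2), of f "\<lambda>_. c"] tangent_const[OF assms(2)] assms(3) by simp

lemma tangent_add_const:
  assumes "u \<in> tangent_space M p" and f: "f \<in> smooth_funs M" and M: "charted M"
  shows "u (\<lambda>q. c + f q) = u f"
proof -
  obtain U \<phi> v where k: "(U, \<phi>) \<in> atlas M" "p \<in> U" "u = coord_vec M (U, \<phi>) p v"
    using assms(1) by (rule tangent_spaceE)
  have "((\<lambda>q. c + f q) \<circ> inv_into U \<phi> has_derivative (\<lambda>h. 0 + frechet_derivative (f \<circ> inv_into U \<phi>) (at (\<phi> p)) h)) (at (\<phi> p))"
    using has_derivative_add[OF has_derivative_const has_derivative_frechet[OF coord_expr_differentiable[OF f k(1,2)]]]
    by (simp add: o_def)
  then show ?thesis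
    using frechet_derivative_eqI smooth_funs_add[OF M smooth_funs_const f]
    by (fastforce simp: k(3) coord_vec_smooth f)
qed

lemma tangent_scale: "u \<in> tangent_space M p \<Longrightarrow> tscale a u \<in> tangent_space M p"
  by (elim tangent_spaceE) (simp add: coord_vec_scale[symmetric] coord_vec_tangent)

lemma tscale_zero: "tscale a 0 = 0" "tscale 0 u = 0"
  by (auto simp: tscale_def)

lemma tscale_minus1: "tscale (- 1) u = - u"
  by (auto simp: tscale_def)

lemma tangent_uminus: "u \<in> tangent_space M p \<Longrightarrow> - u \<in> tangent_space M p"
  using tangent_scale[of u M p "-1"] by (simp add: tscale_minus1)


subsection \<open>Sections along a map\<close>

text \<open>
  A substitute for continuity of \<open>F\<close> between charted spaces: preimages of chart domains have open
  coordinate images, so that smoothness of components there can be handled by calculus on open sets.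
\<close>

definition chart_continuous ::
    "('b, 'f::euclidean_space) mfd \<Rightarrow> ('a, 'e::euclidean_space) mfd \<Rightarrow> ('b \<Rightarrow> 'a) \<Rightarrow> bool" where
  "chart_continuous N M F \<longleftrightarrow> charted N \<and> charted M \<and> F ` points N \<subseteq> points M \<and>
     (\<forall>V \<psi> U \<phi>. (V, \<psi>) \<in> atlas N \<longrightarrow> (U, \<phi>) \<in> atlas M \<longrightarrow> open (\<psi> ` (V \<inter> F -` U)))"

lemma chart_continuous_ident: "charted M \<Longrightarrow> chart_continuous M M (\<lambda>p. p)"
  using charted_open_inter unfolding chart_continuous_def by fastforce

lemma chart_continuousD:
  assumes "chart_continuous N M F"
  shows "charted N" "charted M" "q \<in> points N \<Longrightarrow> F q \<in> points M"
    "(V, \<psi>) \<in> atlas N \<Longrightarrow> (U, \<phi>) \<in> atlas M \<Longrightarrow> open (\<psi> ` (V \<inter> F -` U))"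
  using assms unfolding chart_continuous_def by blast+

lemma sections_alongE:
  assumes "W \<in> sections_along N M F" "(V, \<psi>) \<in> atlas N" "(U, \<phi>) \<in> atlas M"
  obtains w where "smooth_on (\<psi> ` (V \<inter> F -` U)) w"
    "\<And>q. q \<in> V \<Longrightarrow> F q \<in> U \<Longrightarrow> W q = coord_vec M (U, \<phi>) (F q) (w (\<psi> q))"
  using assms unfolding sections_along_def by blast

lemma sections_alongI:
  assumes "\<And>V \<psi> U \<phi>. (V, \<psi>) \<in> atlas N \<Longrightarrow> (U, \<phi>) \<in> atlas M \<Longrightarrow>
     \<exists>w. smooth_on (\<psi> ` (V \<inter> F -` U)) w \<and>
         (\<forall>q. q \<in> V \<longrightarrow> F q \<in> U \<longrightarrow> W q = coord_vec M (U, \<phi>) (F q) (w (\<psi> q)))"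
  shows "W \<in> sections_along N M F"
  using assms unfolding sections_along_def by blast

lemma sections_add:
  assumes F: "chart_continuous N M F" and "W \<in> sections_along N M F" "W' \<in> sections_along N M F"
  shows "W + W' \<in> sections_along N M F"
proof (rule sections_alongI)
  fix V \<psi> U \<phi> assume c: "(V, \<psi>) \<in> atlas N" "(U, \<phi>) \<in> atlas M"
  obtain w w' where "smooth_on (\<psi> ` (V \<inter> F -` U)) w" "smooth_on (\<psi> ` (V \<inter> F -` U)) w'"
    "\<And>q. q \<in> V \<Longrightarrow> F q \<in> U \<Longrightarrow> W q = coord_vec M (U, \<phi>) (F q) (w (\<psi> q))"
    "\<And>q. q \<in> V \<Longrightarrow> F q \<in> U \<Longrightarrow> W' q = coord_vec M (U, \<phi>) (F q) (w' (\<psi> q))"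
    using sections_alongE[OF assms(2) c] sections_alongE[OF assms(3) c] by metis
  then show "\<exists>w. smooth_on (\<psi> ` (V \<inter> F -` U)) w \<and>
      (\<forall>q. q \<in> V \<longrightarrow> F q \<in> U \<longrightarrow> (W + W') q = coord_vec M (U, \<phi>) (F q) (w (\<psi> q)))"
    by (intro exI[of _ "\<lambda>y. w y + w' y"]) (simp add: smooth_on_add chart_continuousD(4)[OF F c] coord_vec_add[OF c(2)])
qed

lemma sections_fscale:
  assumes F: "chart_continuous N M F" and "W \<in> sections_along N M F" "h \<in> smooth_funs N"
  shows "fscale h W \<in> sections_along N M F"
proof (rule sections_alongI)
  fix V \<psi> U \<phi> assume c: "(V, \<psi>) \<in> atlas N" "(U, \<phi>) \<in> atlas M"
  obtain w where w: "smooth_on (\<psi> ` (V \<inter> F -` U)) w"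
    "\<And>q. q \<in> V \<Longrightarrow> F q \<in> U \<Longrightarrow> W q = coord_vec M (U, \<phi>) (F q) (w (\<psi> q))"
    using sections_alongE[OF assms(2) c] by metis
  have "smooth_on (\<psi> ` (V \<inter> F -` U)) (h \<circ> inv_into V \<psi>)"
    by (rule smooth_on_subset[OF smooth_funsD[OF assms(3) c(1)]]) blast
  from smooth_on_scaleR[OF chart_continuousD(4)[OF F c] this w(1)]
  show "\<exists>w. smooth_on (\<psi> ` (V \<inter> F -` U)) w \<and>
      (\<forall>q. q \<in> V \<longrightarrow> F q \<in> U \<longrightarrow> fscale h W q = coord_vec M (U, \<phi>) (F q) (w (\<psi> q)))"
    by (intro exI conjI) (auto simp: w(2) fscale_def coord_vec_scale[OF c(2)] charted_inv[OF chart_continuousD(1)[OF F] c(1)])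
qed

lemma sections_uminus:
  "chart_continuous N M F \<Longrightarrow> W \<in> sections_along N M F \<Longrightarrow> - W \<in> sections_along N M F"
  using sections_fscale[of N M F W "\<lambda>_. -1"] by (simp add: smooth_funs_const fscale_def tscale_minus1 fun_Compl_def)

lemma sections_diff:
  "chart_continuous N M F \<Longrightarrow> W \<in> sections_along N M F \<Longrightarrow> W' \<in> sections_along N M F
    \<Longrightarrow> W - W' \<in> sections_along N M F"
  using sections_add[of N M F W "- W'"] sections_uminus by fastforce

lemma sections_value:
  assumes "chart_continuous N M F" "W \<in> sections_along N M F" "q \<in> points N"
  shows "W q \<in> tangent_space M (F q)"
proof -
  obtain V \<psi> U \<phi> where c: "(V, \<psi>) \<in> atlas N" "q \<in> V" "(U, \<phi>) \<in> atlas M" "F q \<in> U"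
    using charted_chart_at chart_continuousD(1-3)[OF assms(1)] assms(3) by metis
  then show ?thesis by (metis sections_alongE[OF assms(2)] coord_vec_tangent)
qed

lemmas vector_fields_diff = sections_diff[OF chart_continuous_ident]
lemmas vector_fields_value = sections_value[OF chart_continuous_ident]

lemma vector_field_apply_smooth:
  assumes M: "charted M" and X: "X \<in> vector_fields M" and f: "f \<in> smooth_funs M"
  shows "(\<lambda>q. X q f) \<in> smooth_funs M"
proof (rule smooth_funsI[OF M])
  fix U \<phi> assume c: "(U, \<phi>) \<in> atlas M"
  obtain w where w: "smooth_on (\<phi> ` U) w" "\<And>q. q \<in> U \<Longrightarrow> X q = coord_vec M (U, \<phi>) q (w (\<phi> q))"
    by (rule sections_alongE[OF X c c]) auto
  note o = charted_open[OF M c]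
  have "smooth_on (\<phi> ` U) (\<lambda>y. frechet_derivative (f \<circ> inv_into U \<phi>) (at y) (w y))"
    by (rule smooth_on_directional_derivative[OF o o smooth_funsD[OF f c] smooth_on_linear _ w(1)]) auto
  then show "\<exists>h. smooth_on (\<phi> ` U) h \<and> (\<forall>q\<in>U. X q f = h (\<phi> q))"
    by (intro exI conjI) (auto simp: w(2) coord_vec_smooth[OF f])
qed


subsection \<open>The Lie bracket in a chart\<close>

text \<open>
  In a chart \<open>[X, Y] = D w(v) - D v(w)\<close>, where \<open>v\<close> and \<open>w\<close> are the components of \<open>X\<close> and \<open>Y\<close>. The second
  derivatives of the argument cancel by symmetry.
\<close>

lemma lie_bracket_coord:
  assumes M: "charted M" and X: "X \<in> vector_fields M" and Y: "Y \<in> vector_fields M"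
    and c: "(U, \<phi>) \<in> atlas M" and p: "p \<in> U"
    and v: "smooth_on (\<phi> ` U) v" "\<And>q. q \<in> U \<Longrightarrow> X q = coord_vec M (U, \<phi>) q (v (\<phi> q))"
    and w: "smooth_on (\<phi> ` U) w" "\<And>q. q \<in> U \<Longrightarrow> Y q = coord_vec M (U, \<phi>) q (w (\<phi> q))"
  shows "lie_bracket X Y p = coord_vec M (U, \<phi>) p
     (frechet_derivative w (at (\<phi> p)) (v (\<phi> p)) - frechet_derivative v (at (\<phi> p)) (w (\<phi> p)))"
proof
  fix f
  note pM = charted_subset[OF M c p]
  show "lie_bracket X Y p f = coord_vec M (U, \<phi>) p
     (frechet_derivative w (at (\<phi> p)) (v (\<phi> p)) - frechet_derivative v (at (\<phi> p)) (w (\<phi> p))) f"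
  proof (cases "f \<in> smooth_funs M")
    case False
    have "X p (\<lambda>q. Y q f) = 0"
      by (rule tangent_locally_const[OF M vector_fields_value[OF M X pM]])
         (rule tangent_nonsmooth[OF vector_fields_value[OF M Y] False])
    moreover have "Y p (\<lambda>q. X q f) = 0"
      by (rule tangent_locally_const[OF M vector_fields_value[OF M Y pM]])
         (rule tangent_nonsmooth[OF vector_fields_value[OF M X] False])
    ultimately show ?thesis using False by (simp add: lie_bracket_def coord_vec_nonsmooth)
  next
    case True
    define F where "F = f \<circ> inv_into U \<phi>"
    have F: "smooth_on (\<phi> ` U) F" unfolding F_def by (rule smooth_funsD[OF True c])
    note S = charted_open[OF M c]
    have y: "\<phi> p \<in> \<phi> ` U" using p by blast
    have apply_twice: "X p (\<lambda>q. Y q f) = frechet_derivative F (at (\<phi> p)) (frechet_derivative w (at (\<phi> p)) (v (\<phi> p)))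
      + frechet_derivative (\<lambda>z. frechet_derivative F (at z) (w (\<phi> p))) (at (\<phi> p)) (v (\<phi> p))"
      if Y: "Y \<in> vector_fields M"
        and v: "\<And>q. q \<in> U \<Longrightarrow> X q = coord_vec M (U, \<phi>) q (v (\<phi> q))"
        and w: "smooth_on (\<phi> ` U) w" "\<And>q. q \<in> U \<Longrightarrow> Y q = coord_vec M (U, \<phi>) q (w (\<phi> q))"
      for X Y v w
    proof -
      have "X p (\<lambda>q. Y q f) = frechet_derivative ((\<lambda>q. Y q f) \<circ> inv_into U \<phi>) (at (\<phi> p)) (v (\<phi> p))"
        by (simp add: v[OF p] coord_vec_smooth[OF vector_field_apply_smooth[OF M Y True]])
      also have "frechet_derivative ((\<lambda>q. Y q f) \<circ> inv_into U \<phi>) (at (\<phi> p))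
          = frechet_derivative (\<lambda>z. frechet_derivative F (at z) (w z)) (at (\<phi> p))"
        by (rule frechet_derivative_cong_open[OF S y])
           (auto simp: w(2) charted_inv[OF M c] coord_vec_smooth[OF True] F_def)
      finally show ?thesis
        unfolding frechet_derivative_directional[OF S y F w(1)] .
    qed
    have "lie_bracket X Y p f = frechet_derivative F (at (\<phi> p)) (frechet_derivative w (at (\<phi> p)) (v (\<phi> p)))
        - frechet_derivative F (at (\<phi> p)) (frechet_derivative v (at (\<phi> p)) (w (\<phi> p)))"
      using apply_twice[OF Y v(2) w] apply_twice[OF X w(2) v]
        second_derivative_symmetric[OF S F y, of "w (\<phi> p)" "v (\<phi> p)"]
      by (simp add: lie_bracket_def)
    also have "\<dots> = frechet_derivative F (at (\<phi> p))
        (frechet_derivative w (at (\<phi> p)) (v (\<phi> p)) - frechet_derivative v (at (\<phi> p)) (w (\<phi> p)))"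
      using linear_diff[OF linear_frechet_derivative[OF smooth_on_imp_differentiable[OF F y]]] by simp
    finally show ?thesis by (simp add: coord_vec_smooth[OF True] F_def)
  qed
qed

lemma lie_bracket_tangent:
  assumes M: "charted M" and X: "X \<in> vector_fields M" and Y: "Y \<in> vector_fields M" and p: "p \<in> points M"
  shows "lie_bracket X Y p \<in> tangent_space M p"
proof -
  obtain U \<phi> where k: "(U, \<phi>) \<in> atlas M" "p \<in> U" using charted_chart_at[OF M p] .
  obtain v where v: "smooth_on (\<phi> ` U) v" "\<And>q. q \<in> U \<Longrightarrow> X q = coord_vec M (U, \<phi>) q (v (\<phi> q))"
    by (rule sections_alongE[OF X k(1) k(1)]) auto
  obtain w where w: "smooth_on (\<phi> ` U) w" "\<And>q. q \<in> U \<Longrightarrow> Y q = coord_vec M (U, \<phi>) q (w (\<phi> q))"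
    by (rule sections_alongE[OF Y k(1) k(1)]) auto
  show ?thesis using lie_bracket_coord[OF M X Y k v w] coord_vec_tangent[OF k] by simp
qed


subsection \<open>Extension of tangent vectors to vector fields\<close>

lemma coord_vec_change_chart:
  assumes M: "smooth_manifold M" and c: "(U, \<phi>) \<in> atlas M" and c': "(U', \<phi>') \<in> atlas M"
    and p: "p \<in> U" "p \<in> U'"
  shows "coord_vec M (U, \<phi>) p v = coord_vec M (U', \<phi>') p (frechet_derivative (\<phi>' \<circ> inv_into U \<phi>) (at (\<phi> p)) v)"
proof
  fix f
  note ch = smooth_manifold_charted[OF M]
  show "coord_vec M (U, \<phi>) p v f = coord_vec M (U', \<phi>') p (frechet_derivative (\<phi>' \<circ> inv_into U \<phi>) (at (\<phi> p)) v) f"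
  proof (cases "f \<in> smooth_funs M")
    case True
    have tr: "(\<phi>' \<circ> inv_into U \<phi>) differentiable (at (\<phi> p))"
      using smooth_on_imp_differentiable[OF smooth_manifold_transition[OF M c c']] p by blast
    have "(((f \<circ> inv_into U' \<phi>') \<circ> (\<phi>' \<circ> inv_into U \<phi>)) has_derivative
       frechet_derivative (f \<circ> inv_into U' \<phi>') (at (\<phi>' p)) \<circ> frechet_derivative (\<phi>' \<circ> inv_into U \<phi>) (at (\<phi> p)))
       (at (\<phi> p))"
      using has_derivative_frechet[OF coord_expr_differentiable[OF True c' p(2)]]
      by (intro diff_chain_at[OF has_derivative_frechet[OF tr]]) (simp add: charted_inv[OF ch c p(1)])
    then have "frechet_derivative ((f \<circ> inv_into U' \<phi>') \<circ> (\<phi>' \<circ> inv_into U \<phi>)) (at (\<phi> p))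
       = frechet_derivative (f \<circ> inv_into U' \<phi>') (at (\<phi>' p)) \<circ> frechet_derivative (\<phi>' \<circ> inv_into U \<phi>) (at (\<phi> p))"
      by (rule frechet_derivative_eqI)
    moreover have "frechet_derivative (f \<circ> inv_into U \<phi>) (at (\<phi> p))
        = frechet_derivative ((f \<circ> inv_into U' \<phi>') \<circ> (\<phi>' \<circ> inv_into U \<phi>)) (at (\<phi> p))"
      using p by (intro frechet_derivative_cong_open[OF charted_open_inter[OF ch c c']])
        (auto simp: charted_inv[OF ch c] charted_inv[OF ch c'])
    ultimately show ?thesis by (simp add: coord_vec_smooth[OF True])
  qed (simp add: coord_vec_nonsmooth)
qed

text \<open>
  Every coordinate field coincides near a given point with a global vector field: multiply it by a
  bump function \<open>\<beta>\<close> and extend by zero.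
\<close>

lemma coord_field_extension:
  assumes M: "smooth_manifold M" and c: "(U, \<phi>) \<in> atlas M" and p: "p \<in> U"
  obtains X T where "X \<in> vector_fields M" "open T" "\<phi> p \<in> T" "T \<subseteq> \<phi> ` U"
    "\<And>q. q \<in> U \<Longrightarrow> \<phi> q \<in> T \<Longrightarrow> X q = coord_vec M (U, \<phi>) q v"
proof -
  note ch = smooth_manifold_charted[OF M]
  note inv = charted_inv[OF ch]
  obtain \<beta> T K where b: "smooth_on UNIV (\<beta> :: 'b \<Rightarrow> real)" "open T" "\<phi> p \<in> T" "\<And>y. y \<in> T \<Longrightarrow> \<beta> y = 1"
    "compact K" "K \<subseteq> \<phi> ` U" "\<And>y. y \<notin> K \<Longrightarrow> \<beta> y = 0"
    using ex_smooth_bump[OF charted_open[OF ch c], of "\<phi> p"] p by blast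
  \<comment> \<open>The part of \<open>M\<close> outside of which the cut-off coordinate field vanishes. It is compact, hence closed as \<open>M\<close> is
    Hausdorff, so the extension by zero is smooth off \<open>C\<close>.\<close>
  define C where "C = inv_into U \<phi> ` K"
  have "closedin (mtop M) C"
  proof -
    have sub: "U \<subseteq> points M" using charted_subset[OF ch c] by blast
    obtain \<phi>' where hm: "homeomorphic_maps (subtopology (mtop M) U) (top_of_set (\<phi> ` U)) \<phi> \<phi>'"
      using smooth_manifold_chart(3)[OF M c] homeomorphic_map_maps by blast
    have eq: "\<phi>' y = inv_into U \<phi> y" if "y \<in> K" for y
    proof -
      obtain x where "x \<in> U" "y = \<phi> x" using b(6) \<open>y \<in> K\<close> by blast
      then show ?thesis using hm sub inv[OF c] by (auto simp: homeomorphic_maps_def)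
    qed
    have "compactin (top_of_set (\<phi> ` U)) K"
      using b by (simp add: compactin_subtopology)
    then have "compactin (subtopology (mtop M) U) (\<phi>' ` K)"
      using hm image_compactin unfolding homeomorphic_maps_def by blast
    moreover have "\<phi>' ` K = C" using eq by (auto simp: C_def)
    ultimately have "compactin (mtop M) C" by (simp add: compactin_subtopology)
    moreover have "Hausdorff_space (mtop M)" using M by (simp add: smooth_manifold_def)
    ultimately show ?thesis using compactin_imp_closedin by blast
  qed
  then have oC: "openin (mtop M) (points M - C)" by blast
  define X where "X q = (if q \<in> U then coord_vec M (U, \<phi>) q (\<beta> (\<phi> q) *\<^sub>R v) else 0)" for q
  have "X \<in> vector_fields M"
  proof (rule sections_alongI)
    fix V \<psi> U' \<phi>' assume d: "(V, \<psi>) \<in> atlas M" "(U', \<phi>') \<in> atlas M"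
    define q where "q y = inv_into V \<psi> y" for y
    \<comment> \<open>The components of \<open>v\<close> in the chart \<open>\<phi>'\<close>, by the Jacobian of the transition map, as a
      function of the coordinates \<open>\<psi>\<close>.\<close>
    define J where "J y = frechet_derivative (\<phi>' \<circ> inv_into U \<phi>) (at (\<phi> (q y))) v" for y
    define w where "w y = (if q y \<in> U then \<beta> (\<phi> (q y)) *\<^sub>R J y else 0)" for y
    have q: "q (\<psi> x) = x" if "x \<in> V" for x using inv[OF d(1) that] by (simp add: q_def)
    have "smooth_on (\<psi> ` (V \<inter> U')) w"
    proof (rule smooth_on_local)
      fix y assume "y \<in> \<psi> ` (V \<inter> U')"
      then obtain x where x: "x \<in> V" "x \<in> U'" "y = \<psi> x" by blast
      show "\<exists>T. open T \<and> y \<in> T \<and> smooth_on T w"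
      proof (cases "x \<in> U")
        case True
        let ?S = "\<psi> ` (V \<inter> (U \<inter> U'))"
        have S: "open ?S"
          by (intro smooth_manifold_open_image[OF M d(1)] openin_Int smooth_manifold_chart(1)[OF M c]
              smooth_manifold_chart(1)[OF M d(2)])
        have tr: "smooth_on ?S (\<lambda>y. \<phi> (q y))"
          using smooth_on_subset[OF smooth_manifold_transition[OF M d(1) c], of ?S]
          by (auto simp: q_def o_def)
        have "smooth_on ?S (\<lambda>y. \<beta> (\<phi> (q y)))"
          by (rule smooth_on_compose[OF S tr b(1)]) auto
        moreover have "smooth_on ?S J" unfolding J_def
          by (rule smooth_on_directional_derivative[OF S charted_open_inter[OF ch c d(2)]
                smooth_manifold_transition[OF M c d(2)] tr _ smooth_on_const]) (auto simp: q)
        ultimately have "smooth_on ?S (\<lambda>y. \<beta> (\<phi> (q y)) *\<^sub>R J y)"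
          by (rule smooth_on_scaleR[OF S])
        then have "smooth_on ?S w"
          by (subst smooth_on_cong[OF S, of _ "\<lambda>y. \<beta> (\<phi> (q y)) *\<^sub>R J y"]) (auto simp: w_def q)
        then show ?thesis using S True x by blast
      next
        case False
        let ?S = "\<psi> ` (V \<inter> (points M - C))"
        have S: "open ?S" by (rule smooth_manifold_open_image[OF M d(1) oC])
        have "w y = 0" if "y \<in> ?S" for y
        proof -
          obtain x where "x \<in> V" "x \<notin> C" "y = \<psi> x" using \<open>y \<in> ?S\<close> by blast
          then have "\<phi> x \<notin> K" if "x \<in> U" using inv[OF c that] by (force simp: C_def)
          then show ?thesis using \<open>x \<in> V\<close> \<open>y = \<psi> x\<close> b(7) by (auto simp: w_def q)
        qed
        then have "smooth_on ?S w"
          using smooth_on_cong[OF S, of w "\<lambda>_. 0"] smooth_on_const by blast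
        moreover have "x \<notin> C" using False b(6) inv[OF c] by (auto simp: C_def)
        then have "y \<in> ?S" using x charted_subset[OF ch d(1)] by blast
        ultimately show ?thesis using S by blast
      qed
    qed
    moreover have "X x = coord_vec M (U', \<phi>') x (w (\<psi> x))" if "x \<in> V" "x \<in> U'" for x
      using that coord_vec_change_chart[OF M c d(2) _ that(2), of v]
      by (auto simp: X_def w_def q J_def coord_vec_0[OF d(2)] coord_vec_scale[OF c] coord_vec_scale[OF d(2)])
    ultimately show "\<exists>w. smooth_on (\<psi> ` (V \<inter> (\<lambda>p. p) -` U')) w \<and>
      (\<forall>x. x \<in> V \<longrightarrow> x \<in> U' \<longrightarrow> X x = coord_vec M (U', \<phi>') x (w (\<psi> x)))"
      by auto
  qed
  moreover have "T \<subseteq> \<phi> ` U"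
    using b(4,6,7) by fastforce
  ultimately show ?thesis
    using b by (intro that[of X T]) (auto simp: X_def)
qed

lemma tangent_extension:
  assumes M: "smooth_manifold M" and "u \<in> tangent_space M p"
  obtains X where "X \<in> vector_fields M" "X p = u"
  using assms by (metis tangent_spaceE coord_field_extension)

lemma tangent_diff:
  assumes M: "smooth_manifold M" and p: "p \<in> points M"
    and "u \<in> tangent_space M p" "v \<in> tangent_space M p"
  shows "u - v \<in> tangent_space M p"
proof -
  note ch = smooth_manifold_charted[OF M]
  obtain X Y where "X \<in> vector_fields M" "X p = u" "Y \<in> vector_fields M" "Y p = v"
    using tangent_extension[OF M assms(3)] tangent_extension[OF M assms(4)] by metis
  then show ?thesis using vector_fields_value[OF ch vector_fields_diff[OF ch] p, of X Y] by simp
qed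

lemma tangent_add:
  assumes M: "smooth_manifold M" and p: "p \<in> points M"
    and "u \<in> tangent_space M p" "v \<in> tangent_space M p"
  shows "u + v \<in> tangent_space M p"
  using tangent_diff[OF M p assms(3) tangent_uminus[OF assms(4)]] by simp


subsection \<open>Elementary properties of connections\<close>

text \<open>
  A covariant derivative at points of \<open>N\<close> depends on the section at points of \<open>N\<close> only. The difference \<open>Z\<close>
  of two sections that agree there satisfies \<open>Z = h Z\<close> for a function \<open>h\<close> that vanishes on \<open>N\<close>.
\<close>

lemma connection_along_cong:
  assumes F: "chart_continuous N M F" and D: "connection_along N M F D" and V: "V \<in> vector_fields N"
    and W: "W \<in> sections_along N M F" "W' \<in> sections_along N M F"
    and eq: "\<And>q. q \<in> points N \<Longrightarrow> W q = W' q" and p: "p \<in> points N"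
  shows "D V W p = D V W' p"
proof -
  define Z where "Z = W - W'"
  define h :: "'a \<Rightarrow> real" where "h q = (if q \<in> points N then 0 else 1)" for q
  have Z: "Z \<in> sections_along N M F" unfolding Z_def by (rule sections_diff[OF F W])
  have "h \<in> smooth_funs N"
    using smooth_funs_cong[OF chart_continuousD(1)[OF F], of h "\<lambda>_. 0"] smooth_funs_const by (auto simp: h_def)
  then have "D V (fscale h Z) p = tscale (V p h) (Z p) + tscale (h p) (D V Z p)"
    using D V Z p unfolding connection_along_def by blast
  moreover have "fscale h Z = Z"
    by (auto simp: fscale_def tscale_def h_def Z_def eq fun_eq_iff)
  moreover have "Z p = 0" "h p = 0" using p eq by (simp_all add: Z_def h_def)
  ultimately have "D V Z p = 0" by (simp add: tscale_zero)
  moreover have "D V (W' + Z) p = D V W' p + D V Z p"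
    using D V W Z p unfolding connection_along_def by blast
  ultimately show ?thesis by (simp add: Z_def)
qed

lemma connection_along_zero:
  assumes D: "connection_along N M F D" and V: "V \<in> vector_fields N" and N: "charted N"
    and W: "W \<in> sections_along N M F" and p: "p \<in> points N"
  shows "D V 0 p = 0"
proof -
  have "D V (fscale (\<lambda>_. 0) W) p = tscale (V p (\<lambda>_. 0)) (W p) + tscale 0 (D V W p)"
    using D V W p smooth_funs_const[of 0 N] unfolding connection_along_def by blast
  moreover have "fscale (\<lambda>_. 0) W = 0" by (simp add: fscale_def tscale_zero zero_fun_def)
  ultimately show ?thesis
    using tangent_const[OF vector_fields_value[OF N V p], of 0] by (simp add: tscale_zero)
qed


section \<open>Metrics and the Koszul formula\<close>

text \<open>
  A symmetric form on tangent spaces that is additive, expressed through differences because torsion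
  freeness involves the difference of two covariant derivatives. No homogeneity, positivity or smoothness
  is required, so it applies to Riemannian and Lorentzian metrics alike.
\<close>

definition tangent_symmetric_biadditive :: "('a, 'e::euclidean_space) mfd \<Rightarrow> 'a bilin \<Rightarrow> bool" where
  "tangent_symmetric_biadditive M g \<longleftrightarrow> (\<forall>p \<in> points M. \<forall>u \<in> tangent_space M p. \<forall>v \<in> tangent_space M p.
     g p u v = g p v u \<and> (\<forall>w \<in> tangent_space M p. g p (u - v) w = g p u w - g p v w))"

lemma riemannian_metricD:
  assumes "riemannian_metric M g" "p \<in> points M" "u \<in> tangent_space M p"
  shows "v \<in> tangent_space M p \<Longrightarrow> g p u v = g p v u"
    and "v \<in> tangent_space M p \<Longrightarrow> w \<in> tangent_space M p \<Longrightarrow> g p (u + v) w = g p u w + g p v w"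
    and "v \<in> tangent_space M p \<Longrightarrow> g p (tscale a u) v = a * g p u v"
    and "u \<noteq> 0 \<Longrightarrow> g p u u > 0"
  using assms unfolding riemannian_metric_def by blast+

lemma riemannian_metric_smooth:
  "riemannian_metric M g \<Longrightarrow> X \<in> vector_fields M \<Longrightarrow> Y \<in> vector_fields M
    \<Longrightarrow> (\<lambda>p. g p (X p) (Y p)) \<in> smooth_funs M"
  unfolding riemannian_metric_def by (elim conjE) (drule (1) bspec)+

lemma riemannian_metric_diff:
  assumes g: "riemannian_metric M g" and p: "p \<in> points M"
    and u: "u \<in> tangent_space M p" "v \<in> tangent_space M p" "w \<in> tangent_space M p"
  shows "g p (u - v) w = g p u w - g p v w"
  using riemannian_metricD(2)[OF g p u(1) tangent_uminus[OF u(2)] u(3)]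
    riemannian_metricD(3)[OF g p u(2,3), of "-1"] by (simp add: tscale_minus1)

lemma riemannian_metric_biadditive: "riemannian_metric M g \<Longrightarrow> tangent_symmetric_biadditive M g"
  unfolding tangent_symmetric_biadditive_def by (simp add: riemannian_metricD(1) riemannian_metric_diff)

text \<open>
  Global vector fields suffice to separate tangent vectors: extensions of \<open>u\<close> and \<open>v\<close> give a field with
  value \<open>u - v\<close> to test against.
\<close>

lemma riemannian_metric_nondegenerate:
  assumes M: "smooth_manifold M" and g: "riemannian_metric M g" and p: "p \<in> points M"
    and u: "u \<in> tangent_space M p" "v \<in> tangent_space M p"
    and eq: "\<And>X. X \<in> vector_fields M \<Longrightarrow> g p u (X p) = g p v (X p)"
  shows "u = v"
proof -
  note ch = smooth_manifold_charted[OF M]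
  obtain X Y where X: "X \<in> vector_fields M" "X p = u" and Y: "Y \<in> vector_fields M" "Y p = v"
    using tangent_extension[OF M u(1)] tangent_extension[OF M u(2)] by metis
  have Z: "X - Y \<in> vector_fields M" by (rule vector_fields_diff[OF ch X(1) Y(1)])
  have t: "u - v \<in> tangent_space M p" using vector_fields_value[OF ch Z p] X Y by simp
  have "g p (u - v) (u - v) = 0"
    using riemannian_metric_diff[OF g p u t] eq[OF Z] X Y by simp
  then have "u - v = 0" using riemannian_metricD(4)[OF g p t] by force
  then show ?thesis by simp
qed

lemma metric_coord_linear:
  assumes g: "riemannian_metric M g" and ch: "charted M" and c: "(U, \<phi>) \<in> atlas M" and p: "p \<in> U"
    and z: "z \<in> tangent_space M p"
  shows "linear (\<lambda>v. g p (coord_vec M (U, \<phi>) p v) z)"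
proof -
  note D = riemannian_metricD[OF g charted_subset[OF ch c p] coord_vec_tangent[OF c p]]
  show ?thesis
    by (rule linearI) (simp_all add: coord_vec_add[OF c p] coord_vec_scale[OF c p] D z coord_vec_tangent[OF c p])
qed

text \<open>
  The definition of a Riemannian metric gives smoothness for pairs of global fields; extension of
  coordinate fields carries it over to local components.
\<close>

lemma metric_coord_smooth:
  assumes M: "smooth_manifold M" and g: "riemannian_metric M g" and c: "(U, \<phi>) \<in> atlas M"
    and Z: "Z \<in> vector_fields M"
  shows "smooth_on (\<phi> ` U) (\<lambda>y. g (inv_into U \<phi> y) (coord_vec M (U, \<phi>) (inv_into U \<phi> y) v) (Z (inv_into U \<phi> y)))"
proof (rule smooth_on_local)
  fix y assume "y \<in> \<phi> ` U"
  then obtain p where p: "p \<in> U" "y = \<phi> p" by blast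
  note inv = charted_inv[OF smooth_manifold_charted[OF M] c]
  obtain X T where X: "X \<in> vector_fields M" "open T" "\<phi> p \<in> T" "T \<subseteq> \<phi> ` U"
    "\<And>q. q \<in> U \<Longrightarrow> \<phi> q \<in> T \<Longrightarrow> X q = coord_vec M (U, \<phi>) q v"
    using coord_field_extension[OF M c p(1)] by metis
  have "smooth_on T ((\<lambda>p. g p (X p) (Z p)) \<circ> inv_into U \<phi>)"
    using smooth_on_subset[OF smooth_funsD[OF riemannian_metric_smooth[OF g X(1) Z] c] X(4)] .
  then have "smooth_on T
      (\<lambda>y. g (inv_into U \<phi> y) (coord_vec M (U, \<phi>) (inv_into U \<phi> y) v) (Z (inv_into U \<phi> y)))"
  proof (rule smooth_on_cong[OF X(2), THEN iffD1, rotated])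
    show "((\<lambda>p. g p (X p) (Z p)) \<circ> inv_into U \<phi>) y =
     g (inv_into U \<phi> y) (coord_vec M (U, \<phi>) (inv_into U \<phi> y) v) (Z (inv_into U \<phi> y))" if "y \<in> T" for y
      using that X(4,5) inv by auto
  qed
  then show "\<exists>T. open T \<and> y \<in> T \<and> smooth_on T
      (\<lambda>y. g (inv_into U \<phi> y) (coord_vec M (U, \<phi>) (inv_into U \<phi> y) v) (Z (inv_into U \<phi> y)))"
    using X(2,3) p(2) by auto
qed

lemma koszul_formula:
  assumes M: "charted M" and b: "tangent_symmetric_biadditive M g" and D: "levi_civita_connection M g D"
    and X: "X \<in> vector_fields M" and Y: "Y \<in> vector_fields M" and Z: "Z \<in> vector_fields M"
    and p: "p \<in> points M"
  shows "2 * g p (D X Y p) (Z p) = X p (\<lambda>q. g q (Y q) (Z q)) + Y p (\<lambda>q. g q (X q) (Z q)) - Z p (\<lambda>q. g q (X q) (Y q))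
     + g p (lie_bracket X Y p) (Z p) - g p (lie_bracket X Z p) (Y p) - g p (lie_bracket Y Z p) (X p)"
proof -
  have comp: "X p (\<lambda>q. g q (Y q) (Z q)) = g p (D X Y p) (Z p) + g p (Y p) (D X Z p)"
    if "X \<in> vector_fields M" "Y \<in> vector_fields M" "Z \<in> vector_fields M" for X Y Z
    using D that p unfolding levi_civita_connection_def by blast
  have DT: "D X Y p \<in> tangent_space M p" if "X \<in> vector_fields M" "Y \<in> vector_fields M" for X Y
    using D that vector_fields_value[OF M _ p]
    unfolding levi_civita_connection_def connection_along_def by blast
  have T: "X p \<in> tangent_space M p" if "X \<in> vector_fields M" for X
    using that vector_fields_value[OF M _ p] by blast
  have sym: "g p u v = g p v u" if "u \<in> tangent_space M p" "v \<in> tangent_space M p" for u v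
    using b p that unfolding tangent_symmetric_biadditive_def by blast
  have tors: "g p (lie_bracket X Y p) (Z p) = g p (D X Y p) (Z p) - g p (D Y X p) (Z p)"
    if "X \<in> vector_fields M" "Y \<in> vector_fields M" "Z \<in> vector_fields M" for X Y Z
  proof -
    have "D X Y p - D Y X p = lie_bracket X Y p"
      using D that p unfolding levi_civita_connection_def by blast
    then show ?thesis
      using b p DT T that unfolding tangent_symmetric_biadditive_def by (simp flip: \<open>_ = lie_bracket X Y p\<close>)
  qed
  show ?thesis
    unfolding comp[OF X Y Z] comp[OF Y X Z] comp[OF Z X Y] tors[OF X Y Z] tors[OF X Z Y] tors[OF Y Z X]
    using sym[OF T[OF Y] DT[OF X Z]] sym[OF T[OF X] DT[OF Y Z]] sym[OF T[OF X] DT[OF Z Y]]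
    by linarith
qed


section \<open>The ambient manifold\<close>

text \<open>
  The tangent vector \<open>a \<partial>\<^sub>t + b \<partial>\<^sub>r + v\<close> at \<open>q = (t, r, x)\<close>, where the tangent vector \<open>v\<close> of \<open>M\<close> at \<open>x\<close> is carried
  to the slice of constant \<open>t\<close> and \<open>r\<close>.
\<close>

definition ambient_vec :: "('a, 'e::euclidean_space) mfd \<Rightarrow> real \<Rightarrow> real \<times> real \<times> 'a
    \<Rightarrow> real \<Rightarrow> real \<Rightarrow> 'a tvec \<Rightarrow> (real \<times> real \<times> 'a) tvec" where
  "ambient_vec M \<delta> q a b v = tscale a (partial_t M \<delta> q) + tscale b (partial_r M \<delta> q)
     + tdiff (ambient M \<delta>) (\<lambda>y. (fst q, fst (snd q), y)) v"

text \<open>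
  The vector field \<open>a \<partial>\<^sub>t + b \<partial>\<^sub>r + X~\<close> with constant coefficients, \<open>X~\<close> being the lift of \<open>X\<close>.
\<close>

definition ambient_field :: "('a, 'e::euclidean_space) mfd \<Rightarrow> real \<Rightarrow> real \<Rightarrow> real \<Rightarrow> ('a \<Rightarrow> 'a tvec)
    \<Rightarrow> real \<times> real \<times> 'a \<Rightarrow> (real \<times> real \<times> 'a) tvec" where
  "ambient_field M \<delta> a b X q = ambient_vec M \<delta> q a b (X (snd (snd q)))"

lemma ambient_vec_smooth:
  "f \<in> smooth_funs (ambient M \<delta>) \<Longrightarrow> ambient_vec M \<delta> (t, r, x) a b v f
     = a * deriv (\<lambda>s. f (s, r, x)) t + b * deriv (\<lambda>s. f (t, s, x)) r + v (\<lambda>y. f (t, r, y))"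
  by (simp add: ambient_vec_def tscale_def partial_t_def partial_r_def tdiff_def)

lemma ambient_vec_nonsmooth: "f \<notin> smooth_funs (ambient M \<delta>) \<Longrightarrow> ambient_vec M \<delta> q a b v f = 0"
  by (cases q) (simp add: ambient_vec_def tscale_def partial_t_def partial_r_def tdiff_def)

lemma ambient_vec_add: "ambient_vec M \<delta> q a b v + ambient_vec M \<delta> q a' b' v' = ambient_vec M \<delta> q (a + a') (b + b') (v + v')"
  by (auto simp: ambient_vec_def tscale_def tdiff_def algebra_simps)

lemma ambient_vec_diff: "ambient_vec M \<delta> q a b v - ambient_vec M \<delta> q a' b' v' = ambient_vec M \<delta> q (a - a') (b - b') (v - v')"
  by (auto simp: ambient_vec_def tscale_def tdiff_def algebra_simps)

lemma ambient_vec_scale: "tscale k (ambient_vec M \<delta> q a b v) = ambient_vec M \<delta> q (k * a) (k * b) (tscale k v)"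
  by (auto simp: ambient_vec_def tscale_def tdiff_def algebra_simps)

lemma ambient_vec_0: "ambient_vec M \<delta> q 0 0 0 = 0"
  by (auto simp: ambient_vec_def tscale_def tdiff_def)

text \<open>
  In this locale \<open>A\<close> is the ambient manifold, \<open>slab S\<close> is the set of \<open>(t, r, x)\<close> with \<open>t > 0\<close>, \<open>\<bar>r\<bar> < \<delta>\<close>
  and \<open>x \<in> S\<close>, and \<open>slab_chart \<phi>\<close> is the chart of \<open>A\<close> induced by a chart \<open>\<phi>\<close> of \<open>M\<close>.
\<close>

locale ambient_manifold =
  fixes M :: "('a, 'e::euclidean_space) mfd" and \<delta> :: real
  assumes M: "smooth_manifold M" and \<delta>: "\<delta> > 0"
begin

abbreviation "A \<equiv> ambient M \<delta>"

abbreviation slab :: "'x set \<Rightarrow> (real \<times> real \<times> 'x) set" where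
  "slab S \<equiv> {0<..} \<times> {-\<delta><..<\<delta>} \<times> S"

abbreviation slab_chart :: "('a \<Rightarrow> 'e) \<Rightarrow> real \<times> real \<times> 'a \<Rightarrow> real \<times> real \<times> 'e" where
  "slab_chart \<phi> \<equiv> map_prod id (map_prod id \<phi>)"

lemmas charted_base = smooth_manifold_charted[OF M]

lemma points_ambient: "points A = slab (points M)"
  by (simp add: ambient_def prod_manifold_def euclidean_domain_def)

lemma atlas_ambient: "atlas A = {(slab U, slab_chart \<phi>) | U \<phi>. (U, \<phi>) \<in> atlas M}"
  by (auto simp: ambient_def prod_manifold_def euclidean_domain_def)

lemma slab_chart_in_atlas: "(U, \<phi>) \<in> atlas M \<Longrightarrow> (slab U, slab_chart \<phi>) \<in> atlas A"
  unfolding atlas_ambient by blast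

lemma ambient_chartE:
  assumes "(U', \<phi>') \<in> atlas A"
  obtains U \<phi> where "(U, \<phi>) \<in> atlas M" "U' = slab U" "\<phi>' = slab_chart \<phi>"
  using assms unfolding atlas_ambient by blast

lemma slab_chart_image: "slab_chart \<phi> ` slab S = slab (\<phi> ` S)"
  by force

lemma slab_Int: "slab S \<inter> slab T = slab (S \<inter> T)"
  by blast

lemma open_slab: "open S \<Longrightarrow> open (slab S)"
  by (intro open_Times) auto

lemma charted_ambient: "charted A"
  unfolding charted_def
proof (intro conjI allI impI)
  show "points A = \<Union> (fst ` atlas A)"
    using charted_base unfolding points_ambient atlas_ambient charted_def by (auto 4 3)
next
  fix U' \<phi>' assume "(U', \<phi>') \<in> atlas A"
  then show "inj_on \<phi>' U'"
    by (elim ambient_chartE) (simp add: map_prod_inj_on charted_inj[OF charted_base])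
next
  fix U \<phi> V \<psi> assume "(U, \<phi>) \<in> atlas A" "(V, \<psi>) \<in> atlas A"
  then show "open (\<phi> ` (U \<inter> V))"
    by (elim ambient_chartE) (simp only: slab_Int slab_chart_image open_slab charted_open_inter[OF charted_base])
qed

lemma slab_chart_inv:
  assumes "(U, \<phi>) \<in> atlas M" "t > 0" "r \<in> {-\<delta><..<\<delta>}" "x \<in> U"
  shows "inv_into (slab U) (slab_chart \<phi>) (t, r, \<phi> x) = (t, r, x)"
  using charted_inv[OF charted_ambient slab_chart_in_atlas[OF assms(1)], of "(t, r, x)"] assms by simp

lemma ambient_smooth_funsI:
  assumes "\<And>U \<phi>. (U, \<phi>) \<in> atlas M \<Longrightarrow> \<exists>h. smooth_on (slab (\<phi> ` U)) h \<and>
     (\<forall>t r x. 0 < t \<longrightarrow> r \<in> {-\<delta><..<\<delta>} \<longrightarrow> x \<in> U \<longrightarrow> f (t, r, x) = h (t, r, \<phi> x))"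
  shows "f \<in> smooth_funs A"
proof (rule smooth_funsI[OF charted_ambient])
  fix U' \<phi>' assume "(U', \<phi>') \<in> atlas A"
  then obtain U \<phi> where c: "(U, \<phi>) \<in> atlas M" "U' = slab U" "\<phi>' = slab_chart \<phi>" by (rule ambient_chartE)
  obtain h where "smooth_on (slab (\<phi> ` U)) h"
    "\<And>t r x. 0 < t \<Longrightarrow> r \<in> {-\<delta><..<\<delta>} \<Longrightarrow> x \<in> U \<Longrightarrow> f (t, r, x) = h (t, r, \<phi> x)"
    using assms[OF c(1)] by blast
  then show "\<exists>h. smooth_on (\<phi>' ` U') h \<and> (\<forall>p\<in>U'. f p = h (\<phi>' p))"
    unfolding c(2,3) slab_chart_image by (intro exI[of _ h]) auto
qed

lemma ambient_vector_fieldI: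
  assumes "\<And>V \<psi> U \<phi>. (V, \<psi>) \<in> atlas M \<Longrightarrow> (U, \<phi>) \<in> atlas M \<Longrightarrow>
     \<exists>w. smooth_on (slab (\<psi> ` (V \<inter> U))) w \<and>
       (\<forall>t r x. 0 < t \<longrightarrow> r \<in> {-\<delta><..<\<delta>} \<longrightarrow> x \<in> V \<longrightarrow> x \<in> U \<longrightarrow>
          W (t, r, x) = coord_vec A (slab U, slab_chart \<phi>) (t, r, x) (w (t, r, \<psi> x)))"
  shows "W \<in> vector_fields A"
proof (rule sections_alongI)
  fix V' \<psi>' U' \<phi>' assume "(V', \<psi>') \<in> atlas A" "(U', \<phi>') \<in> atlas A"
  then obtain V \<psi> U \<phi> where c: "(V, \<psi>) \<in> atlas M" "V' = slab V" "\<psi>' = slab_chart \<psi>"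
    "(U, \<phi>) \<in> atlas M" "U' = slab U" "\<phi>' = slab_chart \<phi>" by (elim ambient_chartE)
  from assms[OF c(1,4)] obtain w where w: "smooth_on (slab (\<psi> ` (V \<inter> U))) w"
    "\<And>t r x. 0 < t \<Longrightarrow> r \<in> {-\<delta><..<\<delta>} \<Longrightarrow> x \<in> V \<Longrightarrow> x \<in> U \<Longrightarrow>
          W (t, r, x) = coord_vec A (slab U, slab_chart \<phi>) (t, r, x) (w (t, r, \<psi> x))" by blast
  show "\<exists>w. smooth_on (\<psi>' ` (V' \<inter> (\<lambda>p. p) -` U')) w \<and>
         (\<forall>q. q \<in> V' \<longrightarrow> q \<in> U' \<longrightarrow> W q = coord_vec A (U', \<phi>') q (w (\<psi>' q)))"
  proof (intro exI[of _ w] conjI allI impI)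
    show "smooth_on (\<psi>' ` (V' \<inter> (\<lambda>p. p) -` U')) w"
      unfolding c vimage_ident slab_Int slab_chart_image by (rule w(1))
    fix q assume "q \<in> V'" "q \<in> U'"
    then show "W q = coord_vec A (U', \<phi>') q (w (\<psi>' q))"
      using w(2) unfolding c by (cases q) auto
  qed
qed

lemma smooth_on_slice: "open S \<Longrightarrow> smooth_on S (\<lambda>y. (t, r, y))"
  by (intro smooth_on_Pair smooth_on_const smooth_on_linear bounded_linear_ident)

lemma slice_has_derivative: "((\<lambda>y. (t, r, y)) has_derivative (\<lambda>v. (0, 0, v))) (at y)"
  by (intro has_derivative_Pair has_derivative_const has_derivative_ident)

lemma slice_smooth:
  assumes f: "f \<in> smooth_funs A" and t: "t > 0" "r \<in> {-\<delta><..<\<delta>}"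
  shows "(\<lambda>x. f (t, r, x)) \<in> smooth_funs M"
proof (rule smooth_funsI[OF charted_base])
  fix U \<phi> assume c: "(U, \<phi>) \<in> atlas M"
  note F = smooth_funsD[OF f slab_chart_in_atlas[OF c], unfolded slab_chart_image]
  have "smooth_on (\<phi> ` U) (\<lambda>y. (f \<circ> inv_into (slab U) (slab_chart \<phi>)) (t, r, y))"
    by (rule smooth_on_compose[OF charted_open[OF charted_base c] smooth_on_slice[OF charted_open[OF charted_base c]] F])
       (use t in auto)
  then show "\<exists>h. smooth_on (\<phi> ` U) h \<and> (\<forall>x\<in>U. f (t, r, x) = h (\<phi> x))"
    using slab_chart_inv[OF c t] by (intro exI conjI) auto
qed

text \<open>
  Coordinate vectors of the ambient manifold split into \<open>\<partial>\<^sub>t\<close>, \<open>\<partial>\<^sub>r\<close> and a coordinate vector of \<open>M\<close>. All facts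
  about ambient tangent vectors are reduced to this splitting.
\<close>

lemma coord_vec_ambient:
  assumes c: "(U, \<phi>) \<in> atlas M" and x: "x \<in> U" and t: "t > 0" "r \<in> {-\<delta><..<\<delta>}"
  shows "coord_vec A (slab U, slab_chart \<phi>) (t, r, x) (a, b, v) = ambient_vec M \<delta> (t, r, x) a b (coord_vec M (U, \<phi>) x v)"
proof
  fix f
  show "coord_vec A (slab U, slab_chart \<phi>) (t, r, x) (a, b, v) f = ambient_vec M \<delta> (t, r, x) a b (coord_vec M (U, \<phi>) x v) f"
  proof (cases "f \<in> smooth_funs A")
    case False
    then show ?thesis by (simp add: coord_vec_nonsmooth ambient_vec_nonsmooth)
  next
    case f: True
    define F where "F = f \<circ> inv_into (slab U) (slab_chart \<phi>)"
    have F: "F (s, k, \<phi> y) = f (s, k, y)" if "s > 0" "k \<in> {-\<delta><..<\<delta>}" "y \<in> U" for s k y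
      using slab_chart_inv[OF c that] by (simp add: F_def)
    have diff: "F differentiable (at (t, r, \<phi> x))"
      using coord_expr_differentiable[OF f slab_chart_in_atlas[OF c], of "(t, r, x)"] x t by (simp add: F_def)
    let ?D = "frechet_derivative F (at (t, r, \<phi> x))"
    note lin = linear_frechet_derivative[OF diff]
    have "(a, b, v) = a *\<^sub>R (1, 0, 0) + b *\<^sub>R (0, 1, 0) + (0, 0, v)" by simp
    then have "?D (a, b, v) = a * ?D (1, 0, 0) + b * ?D (0, 1, 0) + ?D (0, 0, v)"
      by (simp only: linear_add[OF lin] linear_cmul[OF lin] real_scaleR_def)
    moreover have "deriv (\<lambda>s. f (s, r, x)) t = ?D (1, 0, 0)"
    proof (rule DERIV_imp_deriv)
      have "((\<lambda>s. F ((0, r, \<phi> x) + s *\<^sub>R (1, 0, 0))) has_real_derivative ?D (1, 0, 0)) (at t)"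
        using DERIV_along_line[of F "(0, r, \<phi> x)" t "(1, 0, 0)"] diff by simp
      then show "((\<lambda>s. f (s, r, x)) has_real_derivative ?D (1, 0, 0)) (at t)"
        by (rule has_field_derivative_transform_within_open[where S = "{0<..}"]) (use t x F in auto)
    qed
    moreover have "deriv (\<lambda>s. f (t, s, x)) r = ?D (0, 1, 0)"
    proof (rule DERIV_imp_deriv)
      have "((\<lambda>s. F ((t, 0, \<phi> x) + s *\<^sub>R (0, 1, 0))) has_real_derivative ?D (0, 1, 0)) (at r)"
        using DERIV_along_line[of F "(t, 0, \<phi> x)" r "(0, 1, 0)"] diff by simp
      then show "((\<lambda>s. f (t, s, x)) has_real_derivative ?D (0, 1, 0)) (at r)"
        by (rule has_field_derivative_transform_within_open[where S = "{-\<delta><..<\<delta>}"]) (use t x F in auto)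
    qed
    moreover have "coord_vec M (U, \<phi>) x v (\<lambda>y. f (t, r, y)) = ?D (0, 0, v)"
    proof -
      have "((\<lambda>y. F (t, r, y)) has_derivative (\<lambda>v. ?D (0, 0, v))) (at (\<phi> x))"
        by (rule has_derivative_compose[OF slice_has_derivative has_derivative_frechet[OF diff]])
      then have "frechet_derivative (\<lambda>y. F (t, r, y)) (at (\<phi> x)) v = ?D (0, 0, v)"
        by (simp add: frechet_derivative_eqI)
      moreover have "frechet_derivative ((\<lambda>y. f (t, r, y)) \<circ> inv_into U \<phi>) (at (\<phi> x))
          = frechet_derivative (\<lambda>y. F (t, r, y)) (at (\<phi> x))"
        using x by (intro frechet_derivative_cong_open[OF charted_open[OF charted_base c]])
          (auto simp: charted_inv[OF charted_base c] F[OF t])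
      ultimately show ?thesis by (simp add: coord_vec_smooth[OF slice_smooth[OF f t]])
    qed
    ultimately show ?thesis by (simp add: coord_vec_smooth[OF f] F_def ambient_vec_smooth[OF f])
  qed
qed

lemma ambient_field_vector_field:
  assumes X: "X \<in> vector_fields M" shows "ambient_field M \<delta> a b X \<in> vector_fields A"
proof (rule ambient_vector_fieldI)
  fix V \<psi> U \<phi> assume c: "(V, \<psi>) \<in> atlas M" "(U, \<phi>) \<in> atlas M"
  obtain w where w: "smooth_on (\<psi> ` (V \<inter> U)) w"
    "\<And>q. q \<in> V \<Longrightarrow> q \<in> U \<Longrightarrow> X q = coord_vec M (U, \<phi>) q (w (\<psi> q))"
    by (rule sections_alongE[OF X c]) auto
  have "smooth_on (slab (\<psi> ` (V \<inter> U))) (\<lambda>z. w (snd (snd z)))"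
    by (rule smooth_on_compose[OF open_slab[OF charted_open_inter[OF charted_base c]] smooth_on_linear w(1)])
      (auto intro: bounded_linear_snd_comp bounded_linear_snd)
  then have "smooth_on (slab (\<psi> ` (V \<inter> U))) (\<lambda>z. (a, b, w (snd (snd z))))"
    by (intro smooth_on_Pair smooth_on_const open_slab[OF charted_open_inter[OF charted_base c]])
  then show "\<exists>w. smooth_on (slab (\<psi> ` (V \<inter> U))) w \<and>
       (\<forall>t r x. 0 < t \<longrightarrow> r \<in> {-\<delta><..<\<delta>} \<longrightarrow> x \<in> V \<longrightarrow> x \<in> U \<longrightarrow>
          ambient_field M \<delta> a b X (t, r, x) = coord_vec A (slab U, slab_chart \<phi>) (t, r, x) (w (t, r, \<psi> x)))"
    by (intro exI conjI) (auto simp: coord_vec_ambient[OF c(2)] ambient_field_def w(2))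
qed

lemma ambient_field_bracket:
  assumes X: "X \<in> vector_fields M" and Y: "Y \<in> vector_fields M"
    and q: "t > 0" "r \<in> {-\<delta><..<\<delta>}" "x \<in> points M"
  shows "lie_bracket (ambient_field M \<delta> a b X) (ambient_field M \<delta> c d Y) (t, r, x)
       = ambient_vec M \<delta> (t, r, x) 0 0 (lie_bracket X Y x)"
proof -
  obtain U \<phi> where k: "(U, \<phi>) \<in> atlas M" "x \<in> U" using charted_chart_at[OF charted_base q(3)] .
  obtain v where v: "smooth_on (\<phi> ` U) v" "\<And>q. q \<in> U \<Longrightarrow> X q = coord_vec M (U, \<phi>) q (v (\<phi> q))"
    by (rule sections_alongE[OF X k(1) k(1)]) auto
  obtain w where w: "smooth_on (\<phi> ` U) w" "\<And>q. q \<in> U \<Longrightarrow> Y q = coord_vec M (U, \<phi>) q (w (\<phi> q))"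
    by (rule sections_alongE[OF Y k(1) k(1)]) auto
  define e where "e a b v = (\<lambda>z :: real \<times> real \<times> 'e. (a, b, v (snd (snd z))))"
    for a b :: real and v :: "'e \<Rightarrow> 'e"
  have e: "smooth_on (slab_chart \<phi> ` slab U) (e a b v)"
      "q \<in> slab U \<Longrightarrow> ambient_field M \<delta> a b X q = coord_vec A (slab U, slab_chart \<phi>) q (e a b v (slab_chart \<phi> q))"
    if v: "smooth_on (\<phi> ` U) v" "\<And>q. q \<in> U \<Longrightarrow> X q = coord_vec M (U, \<phi>) q (v (\<phi> q))"
    for a b v X q
  proof -
    have "smooth_on (slab (\<phi> ` U)) (\<lambda>z. v (snd (snd z)))"
      by (rule smooth_on_compose[OF open_slab[OF charted_open[OF charted_base k(1)]] smooth_on_linear v(1)])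
        (auto intro: bounded_linear_snd_comp bounded_linear_snd)
    then show "smooth_on (slab_chart \<phi> ` slab U) (e a b v)"
      unfolding slab_chart_image e_def
      by (intro smooth_on_Pair smooth_on_const open_slab[OF charted_open[OF charted_base k(1)]])
    show "q \<in> slab U \<Longrightarrow> ambient_field M \<delta> a b X q = coord_vec A (slab U, slab_chart \<phi>) q (e a b v (slab_chart \<phi> q))"
      by (cases q) (auto simp: coord_vec_ambient[OF k(1)] ambient_field_def v(2) e_def)
  qed
  have de: "frechet_derivative (e a b v) (at (t, r, \<phi> x)) h = (0, 0, frechet_derivative v (at (\<phi> x)) (snd (snd h)))"
    if "smooth_on (\<phi> ` U) v" for a b v h
  proof -
    have "(v has_derivative frechet_derivative v (at (\<phi> x))) (at (\<phi> x))"
      using k(2) by (intro has_derivative_frechet smooth_on_imp_differentiable[OF that]) auto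
    then have "((\<lambda>z. v (snd (snd z))) has_derivative (\<lambda>h. frechet_derivative v (at (\<phi> x)) (snd (snd h)))) (at (t, r, \<phi> x))"
      by (intro has_derivative_compose[where f = "\<lambda>z. snd (snd z)" and g = v])
        (auto intro!: derivative_eq_intros)
    then have "(e a b v has_derivative (\<lambda>h. (0, 0, frechet_derivative v (at (\<phi> x)) (snd (snd h))))) (at (t, r, \<phi> x))"
      unfolding e_def by (intro has_derivative_Pair has_derivative_const)
    then show ?thesis by (simp add: frechet_derivative_eqI)
  qed
  have "lie_bracket (ambient_field M \<delta> a b X) (ambient_field M \<delta> c d Y) (t, r, x) = coord_vec A (slab U, slab_chart \<phi>) (t, r, x)
     (0, 0, frechet_derivative w (at (\<phi> x)) (v (\<phi> x)) - frechet_derivative v (at (\<phi> x)) (w (\<phi> x)))"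
  proof -
    have at: "slab_chart \<phi> (t, r, x) = (t, r, \<phi> x)" by simp
    have "lie_bracket (ambient_field M \<delta> a b X) (ambient_field M \<delta> c d Y) (t, r, x) = coord_vec A (slab U, slab_chart \<phi>) (t, r, x)
      (frechet_derivative (e c d w) (at (t, r, \<phi> x)) (e a b v (t, r, \<phi> x))
        - frechet_derivative (e a b v) (at (t, r, \<phi> x)) (e c d w (t, r, \<phi> x)))"
      using lie_bracket_coord[OF charted_ambient ambient_field_vector_field[OF X] ambient_field_vector_field[OF Y]
        slab_chart_in_atlas[OF k(1)] _ e[OF v] e[OF w], of "(t, r, x)"] k q unfolding at by blast
    then show ?thesis unfolding de[OF v(1)] de[OF w(1)] by (simp add: e_def)
  qed
  then show ?thesis
    by (simp add: coord_vec_ambient[OF k q(1,2)] lie_bracket_coord[OF charted_base X Y k v w])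
qed

lemma ambient_tangentE:
  assumes "u \<in> tangent_space A (t, r, x)"
  obtains a b v where "t > 0" "r \<in> {-\<delta><..<\<delta>}" "x \<in> points M" "v \<in> tangent_space M x" "u = ambient_vec M \<delta> (t, r, x) a b v"
proof -
  obtain U' \<phi>' w where "(U', \<phi>') \<in> atlas A" "(t, r, x) \<in> U'" "u = coord_vec A (U', \<phi>') (t, r, x) w"
    using assms by (rule tangent_spaceE)
  then obtain U \<phi> where c: "(U, \<phi>) \<in> atlas M" "t > 0" "r \<in> {-\<delta><..<\<delta>}" "x \<in> U"
    "u = coord_vec A (slab U, slab_chart \<phi>) (t, r, x) w"
    by (elim ambient_chartE) auto
  obtain a b v where "w = (a, b, v)" by (cases w)
  then show ?thesis
    using that coord_vec_ambient[OF c(1,4,2,3)] c charted_subset[OF charted_base c(1,4)] coord_vec_tangent[OF c(1,4)] by metis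
qed


subsection \<open>Components of ambient tangent vectors\<close>

lemma smooth_funs_of_t_r: "(\<lambda>(t, r, x). P t r) \<in> smooth_funs A"
  if P: "smooth_on UNIV (\<lambda>z. P (fst z) (snd z))"
proof (rule ambient_smooth_funsI)
  fix U \<phi> assume c: "(U, \<phi>) \<in> atlas M"
  note S = open_slab[OF charted_open[OF charted_base c]]
  have "smooth_on (slab (\<phi> ` U)) (\<lambda>z. (fst z, fst (snd z)))"
    by (intro smooth_on_Pair S smooth_on_linear bounded_linear_fst bounded_linear_fst_comp bounded_linear_snd)
  from smooth_on_compose[OF S this P]
  have "smooth_on (slab (\<phi> ` U)) (\<lambda>z. P (fst z) (fst (snd z)))" by simp
  then show "\<exists>h. smooth_on (slab (\<phi> ` U)) h \<and>
     (\<forall>t r x. 0 < t \<longrightarrow> r \<in> {-\<delta><..<\<delta>} \<longrightarrow> x \<in> U \<longrightarrow> (case (t, r, x) of (t, r, x) \<Rightarrow> P t r) = h (t, r, \<phi> x))"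
    by (intro exI conjI) auto
qed

lemma smooth_pullback:
  assumes f: "f \<in> smooth_funs M" shows "(\<lambda>(t, r, x). f x) \<in> smooth_funs A"
proof (rule ambient_smooth_funsI)
  fix U \<phi> assume c: "(U, \<phi>) \<in> atlas M"
  have "smooth_on (slab (\<phi> ` U)) (\<lambda>z. (f \<circ> inv_into U \<phi>) (snd (snd z)))"
    by (rule smooth_on_compose[OF open_slab[OF charted_open[OF charted_base c]] smooth_on_linear smooth_funsD[OF f c]])
      (auto intro: bounded_linear_snd_comp bounded_linear_snd)
  then show "\<exists>h. smooth_on (slab (\<phi> ` U)) h \<and>
     (\<forall>t r x. 0 < t \<longrightarrow> r \<in> {-\<delta><..<\<delta>} \<longrightarrow> x \<in> U \<longrightarrow> (case (t, r, x) of (t, r, x) \<Rightarrow> f x) = h (t, r, \<phi> x))"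
    by (intro exI conjI) (auto simp: charted_inv[OF charted_base c])
qed

text \<open>
  The three functionals that enter the ambient metric, \<open>dt\<close>, \<open>d(rt)\<close> and the differential of the
  projection to \<open>M\<close>, recover the components of a vector.
\<close>

lemma ambient_vec_dt:
  assumes "v \<in> tangent_space M x"
  shows "ambient_vec M \<delta> (t, r, x) a b v (\<lambda>(t', r', x'). t') = a"
  using smooth_funs_of_t_r[of "\<lambda>t r. t"] tangent_const[OF assms]
  by (simp add: ambient_vec_smooth smooth_on_linear bounded_linear_fst)

lemma ambient_vec_drt:
  assumes "v \<in> tangent_space M x"
  shows "ambient_vec M \<delta> (t, r, x) a b v (\<lambda>(t', r', x'). r' * t') = a * r + b * t"
proof -
  have "smooth_on UNIV (\<lambda>z :: real \<times> real. snd z * fst z)"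
    by (intro smooth_on_mult smooth_on_linear bounded_linear_fst bounded_linear_snd open_UNIV)
  then have s: "(\<lambda>(t', r', x'). r' * t') \<in> smooth_funs A" by (rule smooth_funs_of_t_r)
  have "deriv (\<lambda>s. r * s) t = r" "deriv (\<lambda>s. s * t) r = t"
    by (auto intro!: DERIV_imp_deriv derivative_eq_intros)
  then show ?thesis using tangent_const[OF assms] by (simp add: ambient_vec_smooth[OF s])
qed

lemma ambient_vec_dpr:
  assumes "v \<in> tangent_space M x"
  shows "tdiff M (\<lambda>(t', r', x'). x') (ambient_vec M \<delta> (t, r, x) a b v) = v"
proof
  fix f
  show "tdiff M (\<lambda>(t', r', x'). x') (ambient_vec M \<delta> (t, r, x) a b v) f = v f"
  proof (cases "f \<in> smooth_funs M")
    case True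
    then have "(\<lambda>(t, r, x). f x) \<in> smooth_funs A" by (rule smooth_pullback)
    from ambient_vec_smooth[OF this] have "ambient_vec M \<delta> (t, r, x) a b v (\<lambda>(t, r, x). f x) = v f" by simp
    moreover have "(\<lambda>q :: real \<times> real \<times> 'a. f (case q of (t', r', x') \<Rightarrow> x')) = (\<lambda>(t, r, x). f x)" by auto
    ultimately show ?thesis using True by (simp only: tdiff_def if_True)
  qed (simp add: tdiff_def tangent_nonsmooth[OF assms])
qed

lemma ambient_vec_eq_0:
  assumes "v \<in> tangent_space M x" "ambient_vec M \<delta> (t, r, x) a b v = 0" "t > 0"
  shows "a = 0 \<and> b = 0 \<and> v = 0"
proof -
  have "a = 0" using ambient_vec_dt[OF assms(1), of t r a b] assms(2) by simp
  moreover have "b * t = 0" using ambient_vec_drt[OF assms(1), of t r a b] assms(2) \<open>a = 0\<close> by simp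
  moreover have "v = 0" using ambient_vec_dpr[OF assms(1), of t r a b] assms(2) by (auto simp: tdiff_def)
  ultimately show ?thesis using assms(3) by simp
qed

lemma ambient_metric_components:
  assumes "v \<in> tangent_space M x" "w \<in> tangent_space M x"
  shows "ambient_metric M g \<gamma> (t, r, x) (ambient_vec M \<delta> (t, r, x) a b v) (ambient_vec M \<delta> (t, r, x) c d w)
     = (a * r + b * t) * c + a * (c * r + d * t) + t\<^sup>2 * g x (\<gamma> r x v) w"
  by (simp add: ambient_metric_def Let_def ambient_vec_dt[OF assms(1)] ambient_vec_dt[OF assms(2)]
      ambient_vec_drt[OF assms(1)] ambient_vec_drt[OF assms(2)] ambient_vec_dpr[OF assms(1)] ambient_vec_dpr[OF assms(2)])

lemma Psi_sections:
  assumes Z: "Z \<in> vector_fields A"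
  shows "(\<lambda>x. Z (Psi x)) \<in> sections_along M A Psi"
proof (rule sections_alongI)
  fix V \<psi> U' \<phi>' assume c: "(V, \<psi>) \<in> atlas M" "(U', \<phi>') \<in> atlas A"
  then obtain U \<phi> where d: "(U, \<phi>) \<in> atlas M" "U' = slab U" "\<phi>' = slab_chart \<phi>" by (elim ambient_chartE)
  obtain w where w: "smooth_on (slab_chart \<psi> ` (slab V \<inter> slab U)) w"
    "\<And>q. q \<in> slab V \<Longrightarrow> q \<in> slab U \<Longrightarrow> Z q = coord_vec A (slab U, slab_chart \<phi>) q (w (slab_chart \<psi> q))"
    by (rule sections_alongE[OF Z slab_chart_in_atlas[OF c(1)] slab_chart_in_atlas[OF d(1)]]) auto
  have eq: "V \<inter> Psi -` U' = V \<inter> U" using \<delta> by (auto simp: d Psi_def)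
  have S: "open (\<psi> ` (V \<inter> U))" by (rule charted_open_inter[OF charted_base c(1) d(1)])
  have "smooth_on (\<psi> ` (V \<inter> U)) (\<lambda>y. w (1, 0, y))"
    by (rule smooth_on_compose[OF S smooth_on_slice[OF S] w(1)]) (use \<delta> in \<open>force simp: image_iff\<close>)
  then show "\<exists>w. smooth_on (\<psi> ` (V \<inter> Psi -` U')) w \<and>
         (\<forall>q. q \<in> V \<longrightarrow> Psi q \<in> U' \<longrightarrow> Z (Psi q) = coord_vec A (U', \<phi>') (Psi q) (w (\<psi> q)))"
    unfolding eq using w(2) \<delta> by (intro exI conjI) (auto simp: d Psi_def)
qed

lemma chart_continuous_Psi: "chart_continuous M A Psi"
  unfolding chart_continuous_def
proof (intro conjI allI impI charted_base charted_ambient)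
  show "Psi ` points M \<subseteq> points A" using \<delta> by (auto simp: points_ambient Psi_def)
  fix V \<psi> U' \<phi>' assume c: "(V, \<psi>) \<in> atlas M" "(U', \<phi>') \<in> atlas A"
  then obtain U \<phi> where d: "(U, \<phi>) \<in> atlas M" "U' = slab U" "\<phi>' = slab_chart \<phi>" by (elim ambient_chartE)
  have eq: "V \<inter> Psi -` U' = V \<inter> U" using \<delta> by (auto simp: d Psi_def)
  show "open (\<psi> ` (V \<inter> Psi -` U'))" unfolding eq by (rule charted_open_inter[OF charted_base c(1) d(1)])
qed

end


section \<open>The ambient metric and its Levi-Civita connection\<close>

text \<open>
  The metric \<open>g\<close> and the family \<open>\<gamma>\<close> with those properties of an admissible family that determine the
  Levi-Civita connection of the ambient metric along \<open>\<Psi>\<close>; \<open>gt\<close> is the ambient metric.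
\<close>

locale ambient_metric_family = ambient_manifold M \<delta>
  for M :: "('a, 'e::euclidean_space) mfd" and \<delta> :: real +
  fixes g :: "'a bilin" and \<gamma> :: "real \<Rightarrow> 'a endo"
  assumes g: "riemannian_metric M g"
    and family: "smooth_family_11 M \<gamma>"
    and self_adjoint: "\<And>r p u v. p \<in> points M \<Longrightarrow> u \<in> tangent_space M p \<Longrightarrow> v \<in> tangent_space M p
      \<Longrightarrow> g p (\<gamma> r p u) v = g p u (\<gamma> r p v)"
    and initial: "\<And>p u. p \<in> points M \<Longrightarrow> u \<in> tangent_space M p \<Longrightarrow> \<gamma> 0 p u = u"
begin

abbreviation "gt \<equiv> ambient_metric M g \<gamma>"

lemma gamma_tangent: "p \<in> points M \<Longrightarrow> u \<in> tangent_space M p \<Longrightarrow> \<gamma> r p u \<in> tangent_space M p"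
  using family unfolding smooth_family_11_def tensor_11_def by blast

lemma gamma_diff:
  assumes p: "p \<in> points M" and u: "u \<in> tangent_space M p" "v \<in> tangent_space M p"
  shows "\<gamma> r p (u - v) = \<gamma> r p u - \<gamma> r p v"
proof -
  have "\<gamma> r p (u + - v) = \<gamma> r p u + \<gamma> r p (- v)" "\<gamma> r p (tscale (-1) v) = tscale (-1) (\<gamma> r p v)"
    using family p u tangent_uminus[OF u(2)] unfolding smooth_family_11_def tensor_11_def by blast+
  then show ?thesis by (simp add: tscale_minus1)
qed

lemma ambient_metric_biadditive: "tangent_symmetric_biadditive A gt"
  unfolding tangent_symmetric_biadditive_def
proof (intro ballI conjI)
  fix q u v assume "q \<in> points A" and uv: "u \<in> tangent_space A q" "v \<in> tangent_space A q"
  obtain t r x where q: "q = (t, r, x)" by (cases q)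
  obtain a b u' where u: "x \<in> points M" "u' \<in> tangent_space M x" "u = ambient_vec M \<delta> (t, r, x) a b u'"
    using uv(1) unfolding q by (rule ambient_tangentE)
  obtain c d v' where v: "v' \<in> tangent_space M x" "v = ambient_vec M \<delta> (t, r, x) c d v'"
    using uv(2) unfolding q by (rule ambient_tangentE)
  note metric = ambient_metric_components
  have "g x (\<gamma> r x u') v' = g x (\<gamma> r x v') u'"
    using self_adjoint[OF u(1,2) v(1)] riemannian_metricD(1)[OF g u(1,2) gamma_tangent[OF u(1) v(1)]] by simp
  then show "gt q u v = gt q v u"
    by (simp add: q u(3) v(2) metric[OF u(2) v(1)] metric[OF v(1) u(2)] algebra_simps)
  fix w assume "w \<in> tangent_space A q"
  then obtain k l w' where w: "w' \<in> tangent_space M x" "w = ambient_vec M \<delta> (t, r, x) k l w'"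
    unfolding q by (rule ambient_tangentE)
  have gd: "g x (\<gamma> r x (u' - v')) w' = g x (\<gamma> r x u') w' - g x (\<gamma> r x v') w'"
    unfolding gamma_diff[OF u(1,2) v(1)]
    by (rule riemannian_metric_diff[OF g u(1) gamma_tangent[OF u(1,2)] gamma_tangent[OF u(1) v(1)] w(1)])
  show "gt q (u - v) w = gt q u w - gt q v w"
    by (simp add: gd q u(3) v(2) w(2) ambient_vec_diff metric[OF u(2) w(1)] metric[OF v(1) w(1)]
        metric[OF tangent_diff[OF M u(1,2) v(1)] w(1)]) (simp add: algebra_simps)
qed

lemma family_coord:
  assumes c: "(U, \<phi>) \<in> atlas M" and X: "X \<in> vector_fields M"
  obtains w where "smooth_on (UNIV \<times> \<phi> ` U) w"
    "\<And>r x. x \<in> U \<Longrightarrow> \<gamma> r x (X x) = coord_vec M (U, \<phi>) x (w (r, \<phi> x))"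
proof -
  have "(\<lambda>(r, x). \<gamma> r x (X x)) \<in> sections_along (prod_manifold (euclidean_domain UNIV) M) M snd"
    using family X unfolding smooth_family_11_def by blast
  moreover have "(UNIV \<times> U, map_prod id \<phi>) \<in> atlas (prod_manifold (euclidean_domain (UNIV :: real set)) M)"
    using c by (auto simp: prod_manifold_def euclidean_domain_def)
  ultimately obtain w where w: "smooth_on (map_prod id \<phi> ` (((UNIV :: real set) \<times> U) \<inter> snd -` U)) w"
    "\<And>q. q \<in> UNIV \<times> U \<Longrightarrow> snd q \<in> U \<Longrightarrow> (case q of (r, x) \<Rightarrow> \<gamma> r x (X x))
        = coord_vec M (U, \<phi>) (snd q) (w (map_prod id \<phi> q))"
    using c by (rule sections_alongE) blast
  have "map_prod id \<phi> ` ((UNIV \<times> U) \<inter> snd -` U) = (UNIV :: real set) \<times> \<phi> ` U" by force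
  with w(1) have "smooth_on (UNIV \<times> \<phi> ` U) w" by simp
  moreover have "\<gamma> r x (X x) = coord_vec M (U, \<phi>) x (w (r, \<phi> x))" if "x \<in> U" for r x
    using w(2)[of "(r, x)"] that by simp
  ultimately show ?thesis by (rule that)
qed

lemma family_metric_smooth:
  assumes X: "X \<in> vector_fields M" and Z: "Z \<in> vector_fields M"
  shows "(\<lambda>(t, r, x). g x (\<gamma> r x (X x)) (Z x)) \<in> smooth_funs A"
proof (rule ambient_smooth_funsI)
  fix U \<phi> assume c: "(U, \<phi>) \<in> atlas M"
  obtain w where w: "smooth_on (UNIV \<times> \<phi> ` U) w"
    "\<And>r x. x \<in> U \<Longrightarrow> \<gamma> r x (X x) = coord_vec M (U, \<phi>) x (w (r, \<phi> x))"
    using family_coord[OF c X] by metis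
  define G where "G b y = g (inv_into U \<phi> y) (coord_vec M (U, \<phi>) (inv_into U \<phi> y) b) (Z (inv_into U \<phi> y))" for b y
  define h where "h z = (\<Sum>b\<in>Basis. (w (snd z) \<bullet> b) * G b (snd (snd z)))" for z :: "real \<times> real \<times> 'e"
  note S = open_slab[OF charted_open[OF charted_base c]]
  have "smooth_on (slab (\<phi> ` U)) (\<lambda>z. w (snd z))"
    by (rule smooth_on_compose[OF S smooth_on_linear[OF bounded_linear_snd] w(1)]) auto
  moreover have "smooth_on (slab (\<phi> ` U)) (\<lambda>z. G b (snd (snd z)))" for b
    by (rule smooth_on_compose[OF S smooth_on_linear metric_coord_smooth[OF M g c Z, of b, folded G_def]])
      (auto intro: bounded_linear_snd_comp bounded_linear_snd)
  ultimately have "smooth_on (slab (\<phi> ` U)) h"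
    unfolding h_def by (intro smooth_on_sum smooth_on_mult smooth_on_inner smooth_on_const S)
  moreover have "g x (\<gamma> r x (X x)) (Z x) = h (t, r, \<phi> x)" if "x \<in> U" for t r x
  proof -
    have "Z x \<in> tangent_space M x" by (rule vector_fields_value[OF charted_base Z charted_subset[OF charted_base c that]])
    from linear_expand_basis[OF metric_coord_linear[OF g charted_base c that this], of "w (r, \<phi> x)"]
    show ?thesis by (simp add: h_def G_def w(2)[OF that] charted_inv[OF charted_base c that])
  qed
  ultimately show "\<exists>h. smooth_on (slab (\<phi> ` U)) h \<and> (\<forall>t r x. 0 < t \<longrightarrow> r \<in> {-\<delta><..<\<delta>} \<longrightarrow> x \<in> U \<longrightarrow>
      (case (t, r, x) of (t, r, x) \<Rightarrow> g x (\<gamma> r x (X x)) (Z x)) = h (t, r, \<phi> x))"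
    by auto
qed

lemma family_metric_DERIV:
  assumes X: "X \<in> vector_fields M" and Z: "Z \<in> vector_fields M" and p: "p \<in> points M"
  shows "((\<lambda>s. g p (\<gamma> s p (X p)) (Z p)) has_real_derivative g p (family_deriv \<gamma> r p (X p)) (Z p)) (at r)"
proof -
  obtain U \<phi> where c: "(U, \<phi>) \<in> atlas M" "p \<in> U" using charted_chart_at[OF charted_base p] .
  obtain w where w: "smooth_on (UNIV \<times> \<phi> ` U) w"
    "\<And>r x. x \<in> U \<Longrightarrow> \<gamma> r x (X x) = coord_vec M (U, \<phi>) x (w (r, \<phi> x))"
    using family_coord[OF c(1) X] by metis
  define D where "D = frechet_derivative w (at (r, \<phi> p)) (1, 0)"
  have "w differentiable (at (r, \<phi> p))"
    using c by (intro smooth_on_imp_differentiable[OF w(1)]) auto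
  note w' = has_derivative_frechet[OF this]
  have "((\<lambda>s. w (s, \<phi> p)) has_derivative (\<lambda>h. frechet_derivative w (at (r, \<phi> p)) (h, 0))) (at r)"
    by (rule has_derivative_compose[where f = "\<lambda>s. (s, \<phi> p)" and f' = "\<lambda>h. (h, 0)" and g = w, OF _ w'])
      (intro has_derivative_Pair has_derivative_ident has_derivative_const)
  moreover have "frechet_derivative w (at (r, \<phi> p)) (h, 0) = h *\<^sub>R D" for h
    using linear_cmul[OF has_derivative_linear[OF w'], of h "(1, 0)"] by (simp add: D_def)
  ultimately have wD: "((\<lambda>s. w (s, \<phi> p)) has_vector_derivative D) (at r)"
    by (simp add: has_vector_derivative_def)
  have lin: "((\<lambda>s. L (w (s, \<phi> p))) has_real_derivative L D) (at r)" if "linear L" for L :: "'e \<Rightarrow> real"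
    using bounded_linear.has_vector_derivative[OF linear_conv_bounded_linear[THEN iffD1, OF that] wD]
    by (simp add: has_real_derivative_iff_has_vector_derivative)
  have "family_deriv \<gamma> r p (X p) = coord_vec M (U, \<phi>) p D"
  proof
    fix f
    \<comment> \<open>The derivative of the family is taken argument by argument and is again a coordinate vector,
      namely that of the derivative of the components.\<close>
    have "linear (\<lambda>v. coord_vec M (U, \<phi>) p v f)"
      by (rule linearI) (simp_all add: coord_vec_add[OF c] coord_vec_scale[OF c] tscale_def)
    from DERIV_imp_deriv[OF lin[OF this]]
    show "family_deriv \<gamma> r p (X p) f = coord_vec M (U, \<phi>) p D f"
      by (simp add: family_deriv_def w(2)[OF c(2)])
  qed
  then show ?thesis
    using lin[OF metric_coord_linear[OF g charted_base c vector_fields_value[OF charted_base Z p]]] by (simp add: w(2)[OF c(2)])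
qed

lemma family_deriv_symmetric:
  assumes X: "X \<in> vector_fields M" and Z: "Z \<in> vector_fields M" and p: "p \<in> points M"
  shows "g p (family_deriv \<gamma> r p (X p)) (Z p) = g p (family_deriv \<gamma> r p (Z p)) (X p)"
proof -
  note T = vector_fields_value[OF charted_base X p] vector_fields_value[OF charted_base Z p]
  have "g p (\<gamma> s p (X p)) (Z p) = g p (\<gamma> s p (Z p)) (X p)" for s
    using self_adjoint[OF p T] riemannian_metricD(1)[OF g p T(1) gamma_tangent[OF p T(2)]] by simp
  then show ?thesis
    using family_metric_DERIV[OF X Z p] family_metric_DERIV[OF Z X p] DERIV_unique by (metis (no_types, lifting) ext)
qed

lemma Psi_points: "p \<in> points M \<Longrightarrow> Psi p \<in> points A"
  using \<delta> by (simp add: points_ambient Psi_def)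

lemma ambient_field_Psi: "ambient_field M \<delta> a b X (Psi p) = ambient_vec M \<delta> (1, 0, p) a b (X p)"
  by (simp add: ambient_field_def Psi_def)

lemma ambient_metric_Psi:
  assumes "p \<in> points M" "v \<in> tangent_space M p" "w \<in> tangent_space M p"
  shows "gt (Psi p) (ambient_vec M \<delta> (1, 0, p) a b v) (ambient_vec M \<delta> (1, 0, p) c d w) = b * c + a * d + g p v w"
  using assms by (simp add: ambient_metric_components Psi_def initial)

text \<open>
  The derivative at \<open>\<Psi>(p) = (1, 0, p)\<close> of the inner product of two constant coefficient fields, which is
  \<open>(a r + b t) c + a (c r + d t) + t\<^sup>2 g(\<gamma>(r) X, Y)\<close>, in the direction of a third one.
\<close>

lemma ambient_field_apply_metric:
  assumes X: "X \<in> vector_fields M" and Y: "Y \<in> vector_fields M" and Z: "Z \<in> vector_fields M"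
    and p: "p \<in> points M"
  shows "ambient_field M \<delta> k l Z (Psi p) (\<lambda>q. gt q (ambient_field M \<delta> a b X q) (ambient_field M \<delta> c d Y q))
    = k * (b * c + a * d + 2 * g p (X p) (Y p))
      + l * (2 * a * c + g p (family_deriv \<gamma> 0 p (X p)) (Y p))
      + Z p (\<lambda>x. g x (X x) (Y x))"
proof -
  define G where "G r x = g x (\<gamma> r x (X x)) (Y x)" for r x
  define K where "K = (\<lambda>(t, r, x). ((a * r + b * t) * c + a * (c * r + d * t)) + t\<^sup>2 * G r x)"
  note T = vector_fields_value[OF charted_base]
  have metric: "gt q (ambient_field M \<delta> a b X q) (ambient_field M \<delta> c d Y q) = K q" if "q \<in> points A" for q
  proof -
    obtain t r x where "q = (t, r, x)" by (cases q)
    with that have q: "q = (t, r, x)" "x \<in> points M" unfolding points_ambient by auto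
    show ?thesis
      unfolding q(1) ambient_field_def snd_conv ambient_metric_components[OF T[OF X q(2)] T[OF Y q(2)]] by (simp add: K_def G_def)
  qed
  have K: "K \<in> smooth_funs A"
  proof -
    have "smooth_on UNIV (\<lambda>z::real \<times> real. (a * snd z + b * fst z) * c + a * (c * snd z + d * fst z))"
      by (intro smooth_on_add smooth_on_mult smooth_on_const smooth_on_linear bounded_linear_fst bounded_linear_snd open_UNIV)
    then have s1: "(\<lambda>(t, r, x). (a * r + b * t) * c + a * (c * r + d * t)) \<in> smooth_funs A" by (rule smooth_funs_of_t_r)
    have "smooth_on UNIV (\<lambda>z::real \<times> real. fst z * fst z)"
      by (intro smooth_on_mult smooth_on_linear bounded_linear_fst open_UNIV)
    then have s2: "(\<lambda>(t, r, x). t * t) \<in> smooth_funs A" by (rule smooth_funs_of_t_r)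
    show ?thesis
      using smooth_funs_add[OF charted_ambient s1 smooth_funs_mult[OF charted_ambient s2 family_metric_smooth[OF X Y]]]
      by (simp add: K_def G_def split_def power2_eq_square)
  qed
  have G0: "G 0 x = g x (X x) (Y x)" if "x \<in> points M" for x
    using initial[OF that T[OF X that]] by (simp add: G_def)
  have "ambient_field M \<delta> k l Z (Psi p) (\<lambda>q. gt q (ambient_field M \<delta> a b X q) (ambient_field M \<delta> c d Y q)) = ambient_field M \<delta> k l Z (Psi p) K"
    by (rule tangent_cong[OF charted_ambient vector_fields_value[OF charted_ambient ambient_field_vector_field[OF Z] Psi_points[OF p]] metric])
  also have "\<dots> = k * deriv (\<lambda>s. K (s, 0, p)) 1 + l * deriv (\<lambda>s. K (1, s, p)) 0 + Z p (\<lambda>y. K (1, 0, y))"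
    by (simp add: ambient_field_Psi ambient_vec_smooth[OF K])
  also have "deriv (\<lambda>s. K (s, 0, p)) 1 = b * c + a * d + 2 * g p (X p) (Y p)"
    unfolding K_def by (auto intro!: DERIV_imp_deriv derivative_eq_intros simp: G0[OF p])
  also have "deriv (\<lambda>s. K (1, s, p)) 0 = 2 * a * c + g p (family_deriv \<gamma> 0 p (X p)) (Y p)"
    unfolding K_def
    by (auto intro!: DERIV_imp_deriv derivative_eq_intros family_metric_DERIV[OF X Y p, of 0, folded G_def])
  also have "Z p (\<lambda>y. K (1, 0, y)) = Z p (\<lambda>x. (b * c + a * d) + g x (X x) (Y x))"
    by (rule tangent_cong[OF charted_base T[OF Z p]]) (simp add: K_def G0)
  also have "\<dots> = Z p (\<lambda>x. g x (X x) (Y x))"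
    by (rule tangent_add_const[OF T[OF Z p] riemannian_metric_smooth[OF g X Y] charted_base])
  finally show ?thesis .
qed

lemma ambient_bracket_metric:
  assumes X: "X \<in> vector_fields M" and Y: "Y \<in> vector_fields M" and Z: "Z \<in> vector_fields M"
    and p: "p \<in> points M"
  shows "gt (Psi p) (lie_bracket (ambient_field M \<delta> k l X) (ambient_field M \<delta> a b Y) (Psi p)) (ambient_field M \<delta> c d Z (Psi p))
      = g p (lie_bracket X Y p) (Z p)"
  using \<delta> ambient_metric_Psi[OF p lie_bracket_tangent[OF charted_base X Y p] vector_fields_value[OF charted_base Z p], of 0 0 c d]
    ambient_field_bracket[OF X Y _ _ p, of 1 0 k l a b]
  by (simp add: ambient_field_Psi) (simp add: Psi_def)

text \<open>
  Comparison of the Koszul formulas of the ambient metric and of \<open>g\<close>. The derivatives along \<open>M\<close>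
  and the bracket terms are common to both.
\<close>

lemma ambient_koszul:
  assumes D: "levi_civita_connection M g D" and DA: "levi_civita_connection A gt DA"
    and V: "V \<in> vector_fields M" and Y: "Y \<in> vector_fields M" and Z: "Z \<in> vector_fields M"
    and p: "p \<in> points M"
  shows "gt (Psi p) (DA (ambient_field M \<delta> 0 0 V) (ambient_field M \<delta> a b Y) (Psi p)) (ambient_field M \<delta> c d Z (Psi p))
    = g p (D V Y p) (Z p) + a * g p (V p) (Z p) - c * g p (V p) (Y p)
      + b * g p (family_deriv \<gamma> 0 p (V p)) (Z p) / 2 - d * g p (family_deriv \<gamma> 0 p (V p)) (Y p) / 2"
  using koszul_formula[OF charted_ambient ambient_metric_biadditive DA
      ambient_field_vector_field[OF V] ambient_field_vector_field[OF Y] ambient_field_vector_field[OF Z] Psi_points[OF p], of 0 0 a b c d]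
    koszul_formula[OF charted_base riemannian_metric_biadditive[OF g] D V Y Z p]
  unfolding ambient_bracket_metric[OF V Y Z p] ambient_bracket_metric[OF V Z Y p] ambient_bracket_metric[OF Y Z V p]
    ambient_field_apply_metric[OF Y Z V p] ambient_field_apply_metric[OF V Z Y p] ambient_field_apply_metric[OF V Y Z p]
  by (simp add: algebra_simps)

text \<open>
  Here \<open>P\<close> is an endomorphism field representing half the derivative of the family at 0. In the frame
  \<open>\<xi> = \<partial>\<^sub>t\<close>, \<open>\<ell> = -\<partial>\<^sub>r\<close> the formula contains the second fundamental form of \<open>\<Psi>\<close> (for \<open>a = b = 0\<close>) and the
  Weingarten operators of \<open>\<xi>\<close> (\<open>a = 1\<close>, \<open>Y = 0\<close>) and \<open>\<ell>\<close> (\<open>b = -1\<close>, \<open>Y = 0\<close>).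
\<close>

lemma ambient_connection:
  assumes D: "levi_civita_connection M g D" and DA: "levi_civita_connection A gt DA"
    and P: "\<And>V. V \<in> vector_fields M \<Longrightarrow> (\<lambda>p. P p (V p)) \<in> vector_fields M"
      "\<And>V Z p. V \<in> vector_fields M \<Longrightarrow> Z \<in> vector_fields M \<Longrightarrow> p \<in> points M \<Longrightarrow>
         g p (family_deriv \<gamma> 0 p (V p)) (Z p) = 2 * g p (P p (V p)) (Z p)"
    and V: "V \<in> vector_fields M" and Y: "Y \<in> vector_fields M" and p: "p \<in> points M"
  shows "DA (ambient_field M \<delta> 0 0 V) (ambient_field M \<delta> a b Y) (Psi p)
    = ambient_vec M \<delta> (1, 0, p) (- g p (P p (V p)) (Y p)) (- g p (V p) (Y p))
        (D V Y p + tscale a (V p) + tscale b (P p (V p)))"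
proof -
  note T = vector_fields_value[OF charted_base _ p]
  have "DA (ambient_field M \<delta> 0 0 V) (ambient_field M \<delta> a b Y) \<in> vector_fields A"
    using DA ambient_field_vector_field[OF V] ambient_field_vector_field[OF Y]
    unfolding levi_civita_connection_def connection_along_def by blast
  from vector_fields_value[OF charted_ambient this Psi_points[OF p]]
  obtain k l v where N: "v \<in> tangent_space M p"
    "DA (ambient_field M \<delta> 0 0 V) (ambient_field M \<delta> a b Y) (Psi p) = ambient_vec M \<delta> (1, 0, p) k l v"
    unfolding Psi_def by (rule ambient_tangentE)
  have DVY: "D V Y p \<in> tangent_space M p"
    using D V Y T unfolding levi_civita_connection_def connection_along_def by blast
  \<comment> \<open>Pairing with \<open>c \<partial>\<^sub>t + d \<partial>\<^sub>r + Z\<close> for all \<open>c\<close>, \<open>d\<close> and \<open>Z\<close> determines the components.\<close>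
  have eq: "l * c + k * d + g p v (Z p) = g p (D V Y p) (Z p) + a * g p (V p) (Z p) - c * g p (V p) (Y p)
      + b * g p (P p (V p)) (Z p) - d * g p (P p (V p)) (Y p)" if Z: "Z \<in> vector_fields M" for c d Z
    using ambient_koszul[OF D DA V Y Z p, of a b c d]
    unfolding N(2) ambient_field_Psi ambient_metric_Psi[OF p N(1) T[OF Z]] P(2)[OF V Z p] P(2)[OF V Y p] by simp
  have k: "k = - g p (P p (V p)) (Y p)" using eq[OF V, of 0 1] eq[OF V, of 0 0] by simp
  have l: "l = - g p (V p) (Y p)" using eq[OF V, of 1 0] eq[OF V, of 0 0] by simp
  note tV = tangent_scale[OF T[OF V], of a] and tP = tangent_scale[OF T[OF P(1)[OF V]], of b]
  note t1 = tangent_add[OF M p DVY tV]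
  have "v = D V Y p + tscale a (V p) + tscale b (P p (V p))"
  proof (rule riemannian_metric_nondegenerate[OF M g p N(1) tangent_add[OF M p t1 tP]])
    fix Z assume Z: "Z \<in> vector_fields M"
    show "g p v (Z p) = g p (D V Y p + tscale a (V p) + tscale b (P p (V p))) (Z p)"
      using eq[OF Z, of 0 0]
      by (simp add: riemannian_metricD(2)[OF g p t1 tP T[OF Z]] riemannian_metricD(2)[OF g p DVY tV T[OF Z]]
          riemannian_metricD(3)[OF g p T[OF V] T[OF Z]] riemannian_metricD(3)[OF g p T[OF P(1)[OF V]] T[OF Z]])
  qed
  then show ?thesis using N(2) k l by simp
qed

text \<open>
  The covariant derivative of a section of the tractor bundle in terms of its components. The middle
  coefficient is that of \<open>\<partial>\<^sub>r = -\<ell>\<close>.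
\<close>

lemma tractor_derivative:
  assumes D: "levi_civita_connection M g D" and DA: "levi_civita_connection A gt DA"
    and DT: "pullback_connection M A Psi DA DT"
    and P: "\<And>V. V \<in> vector_fields M \<Longrightarrow> (\<lambda>p. P p (V p)) \<in> vector_fields M"
      "\<And>V Z p. V \<in> vector_fields M \<Longrightarrow> Z \<in> vector_fields M \<Longrightarrow> p \<in> points M \<Longrightarrow>
         g p (family_deriv \<gamma> 0 p (V p)) (Z p) = 2 * g p (P p (V p)) (Z p)"
    and W: "W \<in> sections_along M A Psi" "X \<in> vector_fields M" "W1 \<in> smooth_funs M" "W2 \<in> smooth_funs M"
      "\<And>p. p \<in> points M \<Longrightarrow> W p = tdiff A Psi (X p) + tscale (W1 p) (xi M \<delta> p) + tscale (W2 p) (ell M \<delta> p)"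
    and V: "V \<in> vector_fields M" and p: "p \<in> points M"
  shows "DT V W p = ambient_vec M \<delta> (1, 0, p) (V p W1 - g p (P p (V p)) (X p)) (- V p W2 - g p (V p) (X p))
        (D V X p + tscale (W1 p) (V p) - tscale (W2 p) (P p (V p)))"
proof -
  note T = vector_fields_value[OF charted_base _ p]
  have zero: "0 \<in> vector_fields M" using vector_fields_diff[OF charted_base V V] by simp
  \<comment> \<open>The restrictions to \<open>\<Psi>\<close> of the constant coefficient fields: \<open>T\<Psi> X\<close>, \<open>\<xi>\<close> and \<open>\<ell>\<close> are of this form.\<close>
  define S where "S a b Y x = ambient_field M \<delta> a b Y (Psi x)" for a b Y x
  have S: "S a b Y \<in> sections_along M A Psi" if "Y \<in> vector_fields M" for a b Y
    unfolding S_def by (rule Psi_sections[OF ambient_field_vector_field[OF that]])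
  have Psi_slice: "(\<lambda>y. (1, 0, y)) = Psi" by (simp add: Psi_def fun_eq_iff)
  have S_avec: "S a b Y x = ambient_vec M \<delta> (1, 0, x) a b (Y x)" for a b Y x
    unfolding S_def by (rule ambient_field_Psi)
  have xi_ell: "xi M \<delta> x = partial_t M \<delta> (1, 0, x)" "ell M \<delta> x = - partial_r M \<delta> (1, 0, x)" for x
    by (simp_all add: xi_def ell_def Psi_def)
  have S_values: "S 0 0 X x = tdiff A Psi (X x)" "S 1 0 0 x = xi M \<delta> x" "S 0 (-1) 0 x = ell M \<delta> x" for x
    unfolding S_avec xi_ell by (simp_all add: ambient_vec_def Psi_slice tscale_def tdiff_def fun_eq_iff)
  have DT_S: "DT V (S a b Y) p = DA (ambient_field M \<delta> 0 0 V) (ambient_field M \<delta> a b Y) (Psi p)"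
    if "Y \<in> vector_fields M" for a b Y
  proof -
    \<comment> \<open>The lift of \<open>V\<close> extends \<open>T\<Psi> V\<close>, as the definition of the pullback connection requires.\<close>
    have "ambient_field M \<delta> 0 0 V (Psi p) = tdiff A Psi (V p)"
      by (auto simp: ambient_field_Psi ambient_vec_def Psi_slice tscale_def)
    then show ?thesis
      using DT V p ambient_field_vector_field[OF that] ambient_field_vector_field[OF V]
      unfolding pullback_connection_def S_def by blast
  qed
  have conn: "connection_along M A Psi DT" using DT by (simp add: pullback_connection_def)
  have add: "DT V (Y + Y') p = DT V Y p + DT V Y' p"
    if "Y \<in> sections_along M A Psi" "Y' \<in> sections_along M A Psi" for Y Y'
    using conn V p that unfolding connection_along_def by blast
  have leibniz: "DT V (fscale h Y) p = tscale (V p h) (Y p) + tscale (h p) (DT V Y p)"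
    if "Y \<in> sections_along M A Psi" "h \<in> smooth_funs M" for h Y
    using conn V p that unfolding connection_along_def by blast
  note sec = S[OF W(2), of 0 0] sections_fscale[OF chart_continuous_Psi S[OF zero, of 1 0] W(3)]
    sections_fscale[OF chart_continuous_Psi S[OF zero, of 0 "-1"] W(4)]
  note sec2 = sections_add[OF chart_continuous_Psi sec(1,2)]
  have "DT V W p = DT V (S 0 0 X + fscale W1 (S 1 0 0) + fscale W2 (S 0 (-1) 0)) p"
    by (rule connection_along_cong[OF chart_continuous_Psi conn V W(1) sections_add[OF chart_continuous_Psi sec2 sec(3)] _ p])
      (simp add: W(5) S_values fscale_def)
  also have "\<dots> = DT V (S 0 0 X) p + (tscale (V p W1) (S 1 0 0 p) + tscale (W1 p) (DT V (S 1 0 0) p))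
      + (tscale (V p W2) (S 0 (-1) 0 p) + tscale (W2 p) (DT V (S 0 (-1) 0) p))"
    by (simp only: add[OF sec2 sec(3)] add[OF sec(1,2)] leibniz[OF S[OF zero] W(3)] leibniz[OF S[OF zero] W(4)])
  also have "\<dots> = ambient_vec M \<delta> (1, 0, p) (V p W1 - g p (P p (V p)) (X p)) (- V p W2 - g p (V p) (X p))
        (D V X p + tscale (W1 p) (V p) - tscale (W2 p) (P p (V p)))"
  proof -
    have D0: "D V 0 p = 0"
      by (rule connection_along_zero[OF _ V charted_base zero p]) (use D in \<open>simp add: levi_civita_connection_def\<close>)
    have g0: "g p u 0 = 0" if "u \<in> tangent_space M p" for u
      using riemannian_metric_diff[OF g p T[OF zero] T[OF zero] that]
        riemannian_metricD(1)[OF g p that T[OF zero]] by simp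
    have z: "g p (P p (V p)) 0 = 0" "g p (V p) 0 = 0" using g0 T[OF P(1)[OF V]] T[OF V] by auto
    have ac: "DA (ambient_field M \<delta> 0 0 V) (ambient_field M \<delta> a b Y) (Psi p)
      = ambient_vec M \<delta> (1, 0, p) (- g p (P p (V p)) (Y p)) (- g p (V p) (Y p))
        (D V Y p + tscale a (V p) + tscale b (P p (V p)))" if "Y \<in> vector_fields M" for a b Y
      by (rule ambient_connection[OF D DA _ _ V that p]) (rule P; assumption)+
    have ambient_vec_cong: "k = k' \<Longrightarrow> l = l' \<Longrightarrow> v = v' \<Longrightarrow> ambient_vec M \<delta> q k l v = ambient_vec M \<delta> q k' l' v'"
      for k k' l l' v v' q by simp
    show ?thesis
      unfolding DT_S[OF W(2)] DT_S[OF zero] ac[OF W(2)] ac[OF zero] S_avec ambient_vec_scale ambient_vec_add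
      by (rule ambient_vec_cong) (simp_all add: D0 z tscale_zero, simp add: tscale_def fun_eq_iff)
  qed
  finally show ?thesis .
qed

end


section \<open>Parallel sections of the tractor bundle\<close>

lemma admissible_family_setup:
  assumes "smooth_manifold M" "\<delta> > 0" "riemannian_conformal_structure M c" "g \<in> c" "admissible_family M c \<gamma>"
  shows "ambient_metric_family M \<delta> g \<gamma>"
proof
  show "riemannian_metric M g" using assms(3,4) unfolding riemannian_conformal_structure_def by blast
  show "smooth_family_11 M \<gamma>" using assms(5) unfolding admissible_family_def by blast
  show "\<And>r p u v. p \<in> points M \<Longrightarrow> u \<in> tangent_space M p \<Longrightarrow> v \<in> tangent_space M p
      \<Longrightarrow> g p (\<gamma> r p u) v = g p u (\<gamma> r p v)"
    using assms(4,5) unfolding admissible_family_def by blast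
  show "\<And>p u. p \<in> points M \<Longrightarrow> u \<in> tangent_space M p \<Longrightarrow> \<gamma> 0 p u = u"
    using assms(5) unfolding admissible_family_def by blast
qed (use assms in auto)

theorem proposition6p3:
  fixes M :: "('a, 'e::euclidean_space) mfd"
    and c :: "'a bilin set" and g :: "'a bilin"
    and \<gamma> :: "real \<Rightarrow> 'a endo" and \<delta> :: real
    and nabla :: "('a, 'a) conn" and grad :: "('a \<Rightarrow> real) \<Rightarrow> 'a \<Rightarrow> 'a tvec"
    and Phat :: "'a endo"
    and nabla_amb :: "(real \<times> real \<times> 'a, real \<times> real \<times> 'a) conn"
    and nabla_tr :: "('a, real \<times> real \<times> 'a) conn"
    and W :: "'a \<Rightarrow> (real \<times> real \<times> 'a) tvec"
    and W_top :: "'a \<Rightarrow> 'a tvec" and W1 W2 :: "'a \<Rightarrow> real"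
  assumes "smooth_manifold M" and "connected_space (mtop M)" and "DIM('e) \<ge> 3"
    and "riemannian_conformal_structure M c" and "g \<in> c"
    and "levi_civita_connection M g nabla"
    and "gradient_operator M g grad"
    and "schouten_endomorphism M g nabla Phat"
    and "admissible_family M c \<gamma>" and "\<delta> > 0" and "nonsingular_below M \<gamma> \<delta>"
    and "\<forall>V \<in> vector_fields M. \<forall>U \<in> vector_fields M. \<forall>p \<in> points M.
           g p (family_deriv \<gamma> 0 p (V p)) (U p) = 2 * schouten M g nabla V U p"
    and "levi_civita_connection (ambient M \<delta>) (ambient_metric M g \<gamma>) nabla_amb"
    and "pullback_connection M (ambient M \<delta>) Psi nabla_amb nabla_tr"
    and "W \<in> sections_along M (ambient M \<delta>) Psi"
    and "W_top \<in> vector_fields M" and "W1 \<in> smooth_funs M" and "W2 \<in> smooth_funs M"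
    and "\<forall>p \<in> points M. W p =
           tdiff (ambient M \<delta>) Psi (W_top p) + tscale (W1 p) (xi M \<delta> p) + tscale (W2 p) (ell M \<delta> p)"
  shows "parallel_section M
           (associated_tractor_bundle M (ambient M \<delta>) (ambient_metric M g \<gamma>) nabla_tr Psi (xi M \<delta>)) W
    \<longleftrightarrow> (\<forall>V \<in> vector_fields M. \<forall>p \<in> points M.
           nabla V W_top p = tscale (- W1 p) (V p) + tscale (W2 p) (Phat p (V p)) \<and>
           Phat p (W_top p) = grad W1 p \<and>
           W_top p = - grad W2 p)"
    (is "?parallel \<longleftrightarrow> ?system")
proof -
  interpret ambient_metric_family M \<delta> g \<gamma>
    by (rule admissible_family_setup) (rule assms)+
  have P: "(\<lambda>p. Phat p (V p)) \<in> vector_fields M" if "V \<in> vector_fields M" for V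
    using assms(8) that unfolding schouten_endomorphism_def tensor_11_def by blast
  have gP: "g p (family_deriv \<gamma> 0 p (V p)) (Z p) = 2 * g p (Phat p (V p)) (Z p)"
    if "V \<in> vector_fields M" "Z \<in> vector_fields M" "p \<in> points M" for V Z p
    using assms(8,12) that unfolding schouten_endomorphism_def by simp
  have P_sym: "g p (Phat p (V p)) (W_top p) = g p (Phat p (W_top p)) (V p)"
    if "V \<in> vector_fields M" "p \<in> points M" for V p
    using family_deriv_symmetric[OF that(1) assms(16) that(2), of 0] gP[OF that(1) assms(16) that(2)]
      gP[OF assms(16) that] by simp
  have grad: "grad f \<in> vector_fields M"
    "V \<in> vector_fields M \<Longrightarrow> p \<in> points M \<Longrightarrow> g p (grad f p) (V p) = V p f" if "f \<in> smooth_funs M" for f V p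
    using assms(7) that unfolding gradient_operator_def by blast+
  note T = vector_fields_value[OF charted_base]
  have zero_iff: "nabla_tr V W p = 0 \<longleftrightarrow>
      g p (grad W1 p) (V p) = g p (Phat p (W_top p)) (V p) \<and>
      g p (W_top p) (V p) = g p (- grad W2 p) (V p) \<and>
      nabla V W_top p = tscale (- W1 p) (V p) + tscale (W2 p) (Phat p (V p))"
    if V: "V \<in> vector_fields M" and p: "p \<in> points M" for V p
  proof -
    have DVW: "nabla V W_top p \<in> tangent_space M p"
      using assms(6,16) V T[OF _ p] unfolding levi_civita_connection_def connection_along_def by blast
    note t = tangent_diff[OF M p tangent_add[OF M p DVW tangent_scale[OF T[OF V p], of "W1 p"]]
        tangent_scale[OF T[OF P[OF V] p], of "W2 p"]]
    have DW: "nabla_tr V W p = ambient_vec M \<delta> (1, 0, p)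
        (V p W1 - g p (Phat p (V p)) (W_top p)) (- V p W2 - g p (V p) (W_top p))
        (nabla V W_top p + tscale (W1 p) (V p) - tscale (W2 p) (Phat p (V p)))"
      by (rule tractor_derivative[OF assms(6,13,14) _ _ assms(15-18) _ V p])
        (use P gP assms(19) in auto)
    have "nabla_tr V W p = 0 \<longleftrightarrow> V p W1 - g p (Phat p (V p)) (W_top p) = 0
        \<and> - V p W2 - g p (V p) (W_top p) = 0
        \<and> nabla V W_top p + tscale (W1 p) (V p) - tscale (W2 p) (Phat p (V p)) = 0" (is "_ \<longleftrightarrow> ?z")
    proof
      assume "nabla_tr V W p = 0"
      then show ?z using ambient_vec_eq_0[OF t _ zero_less_one] unfolding DW by blast
    next
      assume ?z
      then show "nabla_tr V W p = 0" unfolding DW by (simp only: ambient_vec_0)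
    qed
    moreover have "g p (- grad W2 p) (V p) = - V p W2"
      using riemannian_metricD(3)[OF g p T[OF grad(1)[OF assms(18)] p] T[OF V p], of "-1"] grad(2)[OF assms(18) V p]
      by (simp add: tscale_minus1)
    moreover have "nabla V W_top p + tscale (W1 p) (V p) - tscale (W2 p) (Phat p (V p)) = 0 \<longleftrightarrow>
        nabla V W_top p = tscale (- W1 p) (V p) + tscale (W2 p) (Phat p (V p))"
      by (auto simp: fun_eq_iff tscale_def algebra_simps add_eq_0_iff2)
    ultimately show ?thesis
      using P_sym[OF V p] grad(2)[OF assms(17) V p] riemannian_metricD(1)[OF g p T[OF V p] T[OF assms(16) p]] by auto
  qed
  have "?parallel \<longleftrightarrow> (\<forall>V \<in> vector_fields M. \<forall>p \<in> points M. nabla_tr V W p = 0)"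
    using assms(15) by (simp add: parallel_section_def associated_tractor_bundle_def)
  also have "\<dots> \<longleftrightarrow> ?system"
  proof
    assume *: "\<forall>V \<in> vector_fields M. \<forall>p \<in> points M. nabla_tr V W p = 0"
    show ?system
    proof (intro ballI conjI)
      fix V p assume V: "V \<in> vector_fields M" and p: "p \<in> points M"
      show "nabla V W_top p = tscale (- W1 p) (V p) + tscale (W2 p) (Phat p (V p))"
        using * zero_iff[OF V p] V p by blast
      show "Phat p (W_top p) = grad W1 p"
        by (rule riemannian_metric_nondegenerate[OF M g p T[OF P[OF assms(16)] p] T[OF grad(1)[OF assms(17)] p]])
          (use * zero_iff[OF _ p] p in simp)
      show "W_top p = - grad W2 p"
        by (rule riemannian_metric_nondegenerate[OF M g p T[OF assms(16) p] tangent_uminus[OF T[OF grad(1)[OF assms(18)] p]]])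
          (use * zero_iff[OF _ p] p in simp)
    qed
  next
    assume ?system
    then show "\<forall>V \<in> vector_fields M. \<forall>p \<in> points M. nabla_tr V W p = 0"
      using zero_iff by (metis (no_types, lifting))
  qed
  finally show ?thesis .
qed

end
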